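(* Let $\mathbb{K}$ be a field, let $1\le k\le n$ be integers, and let $\beta\le\gamma$ be $k$-element subsets of $[n]$. Let $$\Sigma_0=\{\mathcal{P}_t\mid\mathcal{P}_t\ne\emptyset,\ 1\le t\le k-1\},\quad \Sigma_1=\{[\beta',\gamma]\mid\beta\lessdot\beta'\le\gamma\},\quad \Sigma_2=\{[\beta,\gamma']\mid\beta\le\gamma'\lessdot\gamma\},$$ and $\Sigma=\Sigma_0\cup\Sigma_1\cup\Sigma_2$, where $\lessdot$ is the covering relation in the poset $\mathcal{S}(k,n)$. Then each element of $\Sigma$ is a positroid, and $$W_\beta^\gamma=X_\beta^\gamma\setminus\bigcup_{\mathcal{M}\in\Sigma}X_{\mathcal{M}}$$ as open subschemes of the Richardson variety $X_\beta^\gamma$.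
   Context: $[n]=\{1,\dots,n\}$ and $\mathcal{S}(k,n)$ is the set of $k$-element subsets of $[n]$. For $\alpha\in\mathcal{S}(k,n)$, $\alpha(i)$ is the $i$-th smallest element of $\alpha$. Partial order: $\alpha\le\alpha'$ iff $\alpha(i)\le\alpha'(i)$ for all $i=1,\dots,k$; $[\beta,\gamma]=\{\alpha\in\mathcal{S}(k,n)\mid \beta\le\alpha\le\gamma\}$. For integers $a,b$, $[a,b]$ is the interval of integers from $a$ to $b$, empty if $a>b$. $A=\mathbb{K}[\Delta_\alpha\mid\alpha\in\mathcal{S}(k,n)]/I$ is the Plücker coordinate ring of $\mathrm{Gr}(k,n)=\mathrm{Proj}\,A$, where $I$ is the Plücker ideal, i.e. the ideal generated by the quadratic Plücker relations; equivalently, the kernel of the map $\Delta_\alpha\mapsto$ the maximal minor with column set $\alpha$ of a generic $k\times n$ matrix of indeterminates over $\mathbb{K}$. $A_\beta^\gamma=A/\langle\Delta_\alpha\mid\alpha\notin[\beta,\gamma]\rangle$; $X_\beta^\gamma=\mathrm{Proj}\,A_\beta^\gamma$ is the Richardson variety. For $\mathcal{M}\subseteq\mathcal{S}(k,n)$, $X_{\mathcal{M}}=\mathrm{Proj}\,A/\langle\Delta_\alpha\mid\alpha\notin\mathcal{M}\rangle$. For $0\le t\le k$, $\delta_t=\{\beta(1),\dots,\beta(t),\gamma(t+1),\dots,\gamma(k)\}$. $B_\beta^\gamma=A_\beta^\gamma[\Delta_{\delta_0}^{-1},\dots,\Delta_{\delta_k}^{-1}]$ and $W_\beta^\gamma=\mathrm{Proj}\,B_\beta^\gamma$,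 i.e. the open subscheme of $X_\beta^\gamma$ where all $\Delta_{\delta_0},\dots,\Delta_{\delta_k}$ are non-vanishing. For $1\le t\le k-1$, $\mathcal{P}_t=\{\alpha\in[\beta,\gamma]\mid\alpha\cap[\beta(t+1),\gamma(t)]\ne\emptyset\}$. Positroid: a subset $\mathcal{M}\subseteq\mathcal{S}(k,n)$ is a positroid iff $\mathcal{M}=\pi_k([u,v])$ for some permutations $u\le v$ in Bruhat order on the symmetric group $\mathfrak{S}_n$, where $\pi_k(w)=\{w(1),\dots,w(k)\}$ and $u\le v$ iff $\pi_j(u)\le\pi_j(v)$ for all $j\in[n]$. *)

theory Defs
  imports
    "HOL-Library.Poly_Mapping"
    "HOL-Algebra.QuotRing"
    "HOL-Analysis.Function_Topology"
    "Jordan_Normal_Form.Determinant"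
begin

section \<open>The poset of k-subsets and positroids\<close>

definition ksubsets :: "nat \<Rightarrow> nat \<Rightarrow> nat set set" where
  "ksubsets k n = {\<alpha>. \<alpha> \<subseteq> {1..n} \<and> card \<alpha> = k}"

text \<open>The \<open>i\<close>-th smallest element, counting from 1; meaningful for \<open>1 \<le> i \<le> card \<alpha>\<close>.\<close>

definition elt :: "nat set \<Rightarrow> nat \<Rightarrow> nat" where
  "elt \<alpha> i = sorted_list_of_set \<alpha> ! (i - 1)"

definition ple :: "nat \<Rightarrow> nat set \<Rightarrow> nat set \<Rightarrow> bool" where
  "ple k \<alpha> \<alpha>' \<longleftrightarrow> (\<forall>i\<in>{1..k}. elt \<alpha> i \<le> elt \<alpha>' i)"

definition pinterval :: "nat \<Rightarrow> nat \<Rightarrow> nat set \<Rightarrow> nat set \<Rightarrow> nat set set" where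
  "pinterval k n \<beta> \<gamma> = {\<alpha> \<in> ksubsets k n. ple k \<beta> \<alpha> \<and> ple k \<alpha> \<gamma>}"

definition pcovers :: "nat \<Rightarrow> nat \<Rightarrow> nat set \<Rightarrow> nat set \<Rightarrow> bool" where
  "pcovers k n \<alpha> \<alpha>' \<longleftrightarrow> \<alpha> \<in> ksubsets k n \<and> \<alpha>' \<in> ksubsets k n \<and> ple k \<alpha> \<alpha>' \<and> \<alpha> \<noteq> \<alpha>' \<and>
     \<not> (\<exists>\<mu>\<in>ksubsets k n. ple k \<alpha> \<mu> \<and> \<alpha> \<noteq> \<mu> \<and> ple k \<mu> \<alpha>' \<and> \<mu> \<noteq> \<alpha>')"

definition perm_proj :: "nat \<Rightarrow> (nat \<Rightarrow> nat) \<Rightarrow> nat set" where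
  "perm_proj j w = w ` {1..j}"

definition bruhat_le :: "nat \<Rightarrow> (nat \<Rightarrow> nat) \<Rightarrow> (nat \<Rightarrow> nat) \<Rightarrow> bool" where
  "bruhat_le n u v \<longleftrightarrow> (\<forall>j\<in>{1..n}. ple j (perm_proj j u) (perm_proj j v))"

definition bruhat_interval :: "nat \<Rightarrow> (nat \<Rightarrow> nat) \<Rightarrow> (nat \<Rightarrow> nat) \<Rightarrow> (nat \<Rightarrow> nat) set" where
  "bruhat_interval n u v = {w. w permutes {1..n} \<and> bruhat_le n u w \<and> bruhat_le n w v}"

definition positroid :: "nat \<Rightarrow> nat \<Rightarrow> nat set set \<Rightarrow> bool" where
  "positroid k n M \<longleftrightarrow> M \<subseteq> ksubsets k n \<and>
     (\<exists>u v. u permutes {1..n} \<and> v permutes {1..n} \<and> bruhat_le n u v \<and>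
        M = perm_proj k ` bruhat_interval n u v)"

definition delta :: "nat \<Rightarrow> nat set \<Rightarrow> nat set \<Rightarrow> nat \<Rightarrow> nat set" where
  "delta k \<beta> \<gamma> t = elt \<beta> ` {1..t} \<union> elt \<gamma> ` {t+1..k}"

definition Pset :: "nat \<Rightarrow> nat \<Rightarrow> nat set \<Rightarrow> nat set \<Rightarrow> nat \<Rightarrow> nat set set" where
  "Pset k n \<beta> \<gamma> t =
     {\<alpha> \<in> pinterval k n \<beta> \<gamma>. \<alpha> \<inter> {elt \<beta> (t+1)..elt \<gamma> t} \<noteq> {}}"

definition Sigma0 :: "nat \<Rightarrow> nat \<Rightarrow> nat set \<Rightarrow> nat set \<Rightarrow> nat set set set" where
  "Sigma0 k n \<beta> \<gamma> = {Pset k n \<beta> \<gamma> t | t. Pset k n \<beta> \<gamma> t \<noteq> {} \<and> 1 \<le> t \<and> t \<le> k - 1}"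

definition Sigma1 :: "nat \<Rightarrow> nat \<Rightarrow> nat set \<Rightarrow> nat set \<Rightarrow> nat set set set" where
  "Sigma1 k n \<beta> \<gamma> = {pinterval k n \<beta>' \<gamma> | \<beta>'. pcovers k n \<beta> \<beta>' \<and> ple k \<beta>' \<gamma>}"

definition Sigma2 :: "nat \<Rightarrow> nat \<Rightarrow> nat set \<Rightarrow> nat set \<Rightarrow> nat set set set" where
  "Sigma2 k n \<beta> \<gamma> = {pinterval k n \<beta> \<gamma>' | \<gamma>'. ple k \<beta> \<gamma>' \<and> pcovers k n \<gamma>' \<gamma>}"


section \<open>Graded rings and Proj\<close>

record 'a graded_ring = "'a ring" +
  grade :: "nat \<Rightarrow> 'a set"

definition homog :: "('a, 'b) graded_ring_scheme \<Rightarrow> 'a set" where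
  "homog S = (\<Union>d. grade S d)"

definition homogeneous_ideal :: "('a, 'b) graded_ring_scheme \<Rightarrow> 'a set \<Rightarrow> bool" where
  "homogeneous_ideal S J \<longleftrightarrow> ideal J S \<and> J = Idl\<^bsub>S\<^esub> (J \<inter> homog S)"

definition irrelevant_ideal :: "('a, 'b) graded_ring_scheme \<Rightarrow> 'a set" where
  "irrelevant_ideal S = Idl\<^bsub>S\<^esub> (\<Union>d\<in>{1..}. grade S d)"

definition graded_quot :: "('a, 'b) graded_ring_scheme \<Rightarrow> 'a set \<Rightarrow> 'a set graded_ring" where
  "graded_quot S J = ring.extend (S Quot J)
     (graded_ring.fields (\<lambda>d. (\<lambda>x. J +>\<^bsub>S\<^esub> x) ` grade S d))"

definition proj_points :: "('a, 'b) graded_ring_scheme \<Rightarrow> 'a set set" where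
  "proj_points S = {p. primeideal p S \<and> homogeneous_ideal S p \<and> \<not> irrelevant_ideal S \<subseteq> p}"

text \<open>The Zariski topology, presented by its basis of standard open sets \<open>D\<^sub>+(f)\<close>
  with \<open>f\<close> homogeneous (\<open>f = 1\<close> yields the whole space).\<close>

definition proj_topology :: "('a, 'b) graded_ring_scheme \<Rightarrow> 'a set topology" where
  "proj_topology S = topology_generated_by {{p \<in> proj_points S. f \<notin> p} | f. f \<in> homog S}"

text \<open>The structure sheaf: \<open>proj_frac S p a f\<close> is the class of \<open>a / f\<close> in the homogeneous
  localization \<open>S\<^bsub>(p)\<^esub>\<close> at \<open>p\<close>, whose elements are represented by pairs of homogeneous
  elements of equal degree with denominator outside \<open>p\<close>.  A section over \<open>U\<close> is a family of
  elements of \<open>S\<^bsub>(p)\<^esub>\<close>, \<open>p \<in> U\<close>, that is locally given by a single fraction.\<close>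

definition frac_pairs :: "('a, 'b) graded_ring_scheme \<Rightarrow> 'a set \<Rightarrow> ('a \<times> 'a) set" where
  "frac_pairs S p = {(a, f). (\<exists>d. a \<in> grade S d \<and> f \<in> grade S d) \<and> f \<notin> p}"

definition proj_frac ::
  "('a, 'b) graded_ring_scheme \<Rightarrow> 'a set \<Rightarrow> 'a \<Rightarrow> 'a \<Rightarrow> ('a \<times> 'a) set" where
  "proj_frac S p a f = {(b, g) \<in> frac_pairs S p.
     \<exists>h\<in>homog S. h \<notin> p \<and> h \<otimes>\<^bsub>S\<^esub> (a \<otimes>\<^bsub>S\<^esub> g) = h \<otimes>\<^bsub>S\<^esub> (b \<otimes>\<^bsub>S\<^esub> f)}"

definition frac_add ::
  "('a, 'b) graded_ring_scheme \<Rightarrow> 'a set \<Rightarrow> ('a \<times> 'a) set \<Rightarrow> ('a \<times> 'a) set \<Rightarrow> ('a \<times> 'a) set" where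
  "frac_add S p x y = (\<Union>(a, f)\<in>x. \<Union>(b, g)\<in>y.
     proj_frac S p (a \<otimes>\<^bsub>S\<^esub> g \<oplus>\<^bsub>S\<^esub> b \<otimes>\<^bsub>S\<^esub> f) (f \<otimes>\<^bsub>S\<^esub> g))"

definition frac_mult ::
  "('a, 'b) graded_ring_scheme \<Rightarrow> 'a set \<Rightarrow> ('a \<times> 'a) set \<Rightarrow> ('a \<times> 'a) set \<Rightarrow> ('a \<times> 'a) set" where
  "frac_mult S p x y = (\<Union>(a, f)\<in>x. \<Union>(b, g)\<in>y.
     proj_frac S p (a \<otimes>\<^bsub>S\<^esub> b) (f \<otimes>\<^bsub>S\<^esub> g))"

definition proj_sections ::
  "('a, 'b) graded_ring_scheme \<Rightarrow> 'a set set \<Rightarrow> ('a set \<Rightarrow> ('a \<times> 'a) set) ring" where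
  "proj_sections S U =
    \<lparr>carrier = {s \<in> extensional U. \<forall>p\<in>U. \<exists>V a f d.
        openin (proj_topology S) V \<and> p \<in> V \<and> V \<subseteq> U \<and> a \<in> grade S d \<and> f \<in> grade S d \<and>
        (\<forall>q\<in>V. f \<notin> q \<and> s q = proj_frac S q a f)},
     monoid.mult = (\<lambda>s s'. \<lambda>p\<in>U. frac_mult S p (s p) (s' p)),
     one = (\<lambda>p\<in>U. proj_frac S p \<one>\<^bsub>S\<^esub> \<one>\<^bsub>S\<^esub>),
     zero = (\<lambda>p\<in>U. proj_frac S p \<zero>\<^bsub>S\<^esub> \<one>\<^bsub>S\<^esub>),
     add = (\<lambda>s s'. \<lambda>p\<in>U. frac_add S p (s p) (s' p))\<rparr>"

text \<open>A topological space with a presheaf of rings on its open sets; \<open>rs_res X U V\<close> is the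
  restriction from \<open>U\<close> to \<open>V \<subseteq> U\<close>.\<close>

record ('p, 's) ringed_space =
  rs_top :: "'p topology"
  rs_sections :: "'p set \<Rightarrow> 's ring"
  rs_res :: "'p set \<Rightarrow> 'p set \<Rightarrow> 's \<Rightarrow> 's"

definition Proj ::
  "('a, 'b) graded_ring_scheme \<Rightarrow> ('a set, 'a set \<Rightarrow> ('a \<times> 'a) set) ringed_space" where
  "Proj S = \<lparr>rs_top = proj_topology S, rs_sections = proj_sections S, rs_res = (\<lambda>U V s. restrict s V)\<rparr>"

definition open_subscheme :: "('p, 's) ringed_space \<Rightarrow> 'p set \<Rightarrow> ('p, 's) ringed_space" where
  "open_subscheme X U =
    \<lparr>rs_top = subtopology (rs_top X) U,
     rs_sections = restrict (rs_sections X) {V. openin (rs_top X) V \<and> V \<subseteq> U},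
     rs_res = rs_res X\<rparr>"


section \<open>Polynomial rings and the Pluecker algebra\<close>

type_synonym ('x, 'k) mpol = "('x \<Rightarrow>\<^sub>0 nat) \<Rightarrow>\<^sub>0 'k"

definition mvar :: "'x \<Rightarrow> ('x, 'k::field) mpol" where
  "mvar x = Poly_Mapping.single (Poly_Mapping.single x 1) 1"

definition mvars :: "('x, 'k::field) mpol \<Rightarrow> 'x set" where
  "mvars p = (\<Union>m\<in>Poly_Mapping.keys p. Poly_Mapping.keys m)"

definition mdeg :: "('x \<Rightarrow>\<^sub>0 nat) \<Rightarrow> nat" where
  "mdeg m = (\<Sum>x\<in>Poly_Mapping.keys m. Poly_Mapping.lookup m x)"

definition poly_ring :: "'x set \<Rightarrow> ('x, 'k::field) mpol graded_ring" where
  "poly_ring V =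
    \<lparr>carrier = {p. mvars p \<subseteq> V}, monoid.mult = (*), one = 1, zero = 0, add = (+),
     grade = (\<lambda>d. {p. mvars p \<subseteq> V \<and> (\<forall>m\<in>Poly_Mapping.keys p. mdeg m = d)})\<rparr>"

text \<open>The \<open>'k\<close>-algebra homomorphism sending the variable \<open>x\<close> to \<open>f x\<close>.\<close>

definition msubst :: "('x \<Rightarrow> ('y, 'k::field) mpol) \<Rightarrow> ('x, 'k) mpol \<Rightarrow> ('y, 'k) mpol" where
  "msubst f p = (\<Sum>m\<in>Poly_Mapping.keys p.
     Poly_Mapping.single 0 (Poly_Mapping.lookup p m) *
     (\<Prod>x\<in>Poly_Mapping.keys m. f x ^ Poly_Mapping.lookup m x))"

text \<open>The maximal minor of the generic \<open>k \<times> n\<close> matrix with column set \<open>\<alpha>\<close>; the entry in row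
  \<open>i\<close> and column \<open>j\<close> is the variable \<open>(i, j)\<close>.  Indices of \<open>mat\<close> start at 0.\<close>

definition generic_minor :: "nat \<Rightarrow> nat set \<Rightarrow> (nat \<times> nat, 'k::field) mpol" where
  "generic_minor k \<alpha> = det (mat k k (\<lambda>(i, j). mvar (i + 1, elt \<alpha> (j + 1))))"

text \<open>The Pluecker ideal is taken as the kernel of the parametrization by maximal minors,
  which is the ideal of quadratic relations over a field of any characteristic.\<close>

definition plucker_ideal :: "'k::field itself \<Rightarrow> nat \<Rightarrow> nat \<Rightarrow> (nat set, 'k) mpol set" where
  "plucker_ideal K k n =
     {p \<in> carrier (poly_ring (ksubsets k n)). msubst (generic_minor k) p = 0}"

definition plucker_algebra ::
  "'k::field itself \<Rightarrow> nat \<Rightarrow> nat \<Rightarrow> (nat set, 'k) mpol set graded_ring" where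
  "plucker_algebra K k n = graded_quot (poly_ring (ksubsets k n)) (plucker_ideal K k n)"

definition plucker_coord ::
  "'k::field itself \<Rightarrow> nat \<Rightarrow> nat \<Rightarrow> nat set \<Rightarrow> (nat set, 'k) mpol set" where
  "plucker_coord K k n \<alpha> =
     plucker_ideal K k n +>\<^bsub>(poly_ring (ksubsets k n) :: (nat set, 'k) mpol graded_ring)\<^esub> mvar \<alpha>"

definition vanishing_ideal ::
  "'k::field itself \<Rightarrow> nat \<Rightarrow> nat \<Rightarrow> nat set set \<Rightarrow> (nat set, 'k) mpol set set" where
  "vanishing_ideal K k n M =
     Idl\<^bsub>plucker_algebra K k n\<^esub> (plucker_coord K k n ` (ksubsets k n - M))"

definition coord_ring ::
  "'k::field itself \<Rightarrow> nat \<Rightarrow> nat \<Rightarrow> nat set set \<Rightarrow> (nat set, 'k) mpol set set graded_ring" where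
  "coord_ring K k n M = graded_quot (plucker_algebra K k n) (vanishing_ideal K k n M)"

text \<open>The residue class of \<open>\<Delta>\<^sub>\<alpha>\<close> in \<open>coord_ring K k n M\<close>.\<close>

definition coord_fun ::
  "'k::field itself \<Rightarrow> nat \<Rightarrow> nat \<Rightarrow> nat set set \<Rightarrow> nat set \<Rightarrow> (nat set, 'k) mpol set set" where
  "coord_fun K k n M \<alpha> =
     vanishing_ideal K k n M +>\<^bsub>plucker_algebra K k n\<^esub> plucker_coord K k n \<alpha>"

type_synonym 'k plucker_scheme =
  "((nat set, 'k) mpol set set set,
    (nat set, 'k) mpol set set set \<Rightarrow>
      ((nat set, 'k) mpol set set \<times> (nat set, 'k) mpol set set) set) ringed_space"

definition X_of :: "'k::field itself \<Rightarrow> nat \<Rightarrow> nat \<Rightarrow> nat set set \<Rightarrow> 'k plucker_scheme" where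
  "X_of K k n M = Proj (coord_ring K k n M)"

definition richardson ::
  "'k::field itself \<Rightarrow> nat \<Rightarrow> nat \<Rightarrow> nat set \<Rightarrow> nat set \<Rightarrow> 'k plucker_scheme" where
  "richardson K k n \<beta> \<gamma> = X_of K k n (pinterval k n \<beta> \<gamma>)"

text \<open>For \<open>M \<subseteq> N\<close>, the underlying closed subset of the closed subscheme \<open>X_of K k n M\<close>
  of \<open>X_of K k n N\<close>: the image of the closed immersion induced by the projection
  \<open>coord_ring K k n N \<rightarrow> coord_ring K k n M\<close>, which sends a coset \<open>c\<close> of the smaller ideal
  to the coset \<open>J + c\<close> of the larger ideal \<open>J = vanishing_ideal K k n M\<close>.\<close>

definition closed_points_in ::
  "'k::field itself \<Rightarrow> nat \<Rightarrow> nat \<Rightarrow> nat set set \<Rightarrow> nat set set \<Rightarrow>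
     (nat set, 'k) mpol set set set set" where
  "closed_points_in K k n N M =
     (\<lambda>q. {c \<in> carrier (coord_ring K k n N).
            vanishing_ideal K k n M <+>\<^bsub>plucker_algebra K k n\<^esub> c \<in> q})
       ` topspace (rs_top (X_of K k n M))"

definition W_open ::
  "'k::field itself \<Rightarrow> nat \<Rightarrow> nat \<Rightarrow> nat set \<Rightarrow> nat set \<Rightarrow> 'k plucker_scheme" where
  "W_open K k n \<beta> \<gamma> = open_subscheme (richardson K k n \<beta> \<gamma>)
     {p \<in> topspace (rs_top (richardson K k n \<beta> \<gamma>)).
        \<forall>t\<in>{0..k}. coord_fun K k n (pinterval k n \<beta> \<gamma>) (delta k \<beta> \<gamma> t) \<notin> p}"

end

theory Submission
  imports Defs
begin

text \<open>
  The positroid claim and the geometric claim have independent proofs.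

  Positroids.  Let \<open>a \<in> \<beta>\<close> and \<open>b \<in> \<gamma>\<close>.  Let \<open>u\<close> be the permutation that lists \<open>a\<close>, then the
  rest of \<open>\<beta>\<close> in increasing order, then the complement of \<open>\<beta>\<close> in increasing order; let \<open>v\<close> be the
  mirror image of this construction for \<open>\<gamma>\<close> and \<open>b\<close>.  Counting elements below a threshold shows
  that \<open>u \<le> w \<le> v\<close> holds if and only if \<open>\<pi>\<^sub>k(w) \<in> [\<beta>, \<gamma>]\<close> and \<open>a \<le> w(1) \<le> b\<close>.  Hence the
  members of \<open>[\<beta>, \<gamma>]\<close> that meet the integer interval from \<open>a\<close> to \<open>b\<close> form a positroid as soon as
  there are any (\<open>positroid_interval_meet\<close>).  The sets \<open>\<P>\<^sub>t\<close> are the case \<open>a = \<beta>(t + 1)\<close>,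
  \<open>b = \<gamma>(t)\<close>; a whole interval is the case \<open>a = min \<beta>\<close>, \<open>b = max \<gamma>\<close>.

  Geometry.  For a point \<open>p\<close> of the Richardson variety let \<open>M\<^sub>p\<close> be the set of those \<open>\<alpha>\<close> for which
  \<open>\<Delta>\<^sub>\<alpha>\<close> does not vanish at \<open>p\<close>.  Then \<open>p\<close> lies on \<open>X\<^sub>M\<close> if and only if \<open>M\<^sub>p \<subseteq> M\<close>
  (\<open>mem_closed_points_iff\<close>), so both sides of the asserted equality are described by \<open>M\<^sub>p\<close> alone.
  It is nonempty because \<open>p\<close> does not contain the irrelevant ideal, it is contained in \<open>[\<beta>, \<gamma>]\<close>,
  and it has the symmetric exchange property of the bases of a matroid
  (\<open>symmetric_exchange_nonvanishing\<close>), since \<open>p\<close> is prime and \<open>\<Delta>\<^sub>B \<Delta>\<^sub>C\<close> is a signed sum of products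
  \<open>\<Delta>\<^bsub>B - x + y\<^esub> \<Delta>\<^bsub>C - y + x\<^esub>\<close> over \<open>x \<in> B - C\<close>.

  The rest is a statement on such families (\<open>delta_mem_iff_not_subset\<close>).  A nonempty family \<open>M\<close> with
  symmetric exchange has a least and a greatest element.  If the least one is not \<open>\<beta> = \<delta>\<^sub>k\<close>, then
  \<open>M\<close> lies above some cover of \<open>\<beta>\<close>; dually for \<open>\<gamma> = \<delta>\<^sub>0\<close>.  If both \<open>\<beta>\<close> and \<open>\<gamma>\<close> belong to \<open>M\<close>
  and some \<open>\<alpha> \<in> M\<close> avoids the interval from \<open>\<beta>(t + 1)\<close> to \<open>\<gamma>(t)\<close>, then \<open>\<alpha>\<close> has \<open>t\<close> elements below
  and \<open>k - t\<close> elements above this interval; exchanging the former for \<open>\<beta>(1), \<dots>, \<beta>(t)\<close> and the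
  latter for \<open>\<gamma>(t + 1), \<dots>, \<gamma>(k)\<close> turns \<open>\<alpha>\<close> into \<open>\<delta>\<^sub>t\<close> within \<open>M\<close>.  So \<open>\<delta>\<^sub>t \<in> M\<close> unless
  \<open>M \<subseteq> \<P>\<^sub>t\<close>.  In the other direction, \<open>\<delta>\<^sub>t \<notin> \<P>\<^sub>t\<close>, and \<open>\<beta>\<close> and \<open>\<gamma>\<close> lie in none of the smaller
  intervals.
\<close>

section \<open>The Gale order through counting\<close>

lemma elt_image:
  assumes "finite A" "card A = k"
  shows "elt A ` {1..k} = A" "inj_on (elt A) {1..k}"
proof -
  let ?xs = "sorted_list_of_set A"
  have len: "length ?xs = k" using assms by simp
  have "elt A ` {1..k} = (!) ?xs ` {..<k}"
  proof -
    have "{1..k} = Suc ` {..<k}" by (simp add: image_Suc_lessThan)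
    then show ?thesis by (simp add: image_image elt_def)
  qed
  also have "\<dots> = set ?xs" using len by (auto simp: set_conv_nth)
  finally show "elt A ` {1..k} = A" using assms by simp
  then show "inj_on (elt A) {1..k}"
    using assms by (metis card_atLeastAtMost diff_Suc_1 eq_card_imp_inj_on finite_atLeastAtMost)
qed

lemma elt_in:
  assumes "finite A" "1 \<le> i" "i \<le> card A"
  shows "elt A i \<in> A"
  using elt_image(1)[OF assms(1) refl] assms by force

lemma elt_less:
  assumes "finite A" "1 \<le> i" "i < j" "j \<le> card A"
  shows "elt A i < elt A j"
  unfolding elt_def
  using assms by (intro sorted_wrt_nth_less[OF sorted_list_of_set.strict_sorted_key_list_of_set]) auto

lemma elt_le_iff:
  assumes "finite A" "1 \<le> i" "i \<le> card A"
  shows "elt A i \<le> m \<longleftrightarrow> i \<le> card (A \<inter> {..m})"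
proof
  assume le: "elt A i \<le> m"
  have "elt A ` {1..i} \<subseteq> A \<inter> {..m}"
  proof
    fix x assume "x \<in> elt A ` {1..i}"
    then obtain j where j: "x = elt A j" "1 \<le> j" "j \<le> i" by auto
    have "x \<le> elt A i" using elt_less[of A j i] j assms by (cases "j = i") auto
    moreover have "x \<in> A" using elt_in[of A j] j assms by simp
    ultimately show "x \<in> A \<inter> {..m}" using le by auto
  qed
  then have "card (elt A ` {1..i}) \<le> card (A \<inter> {..m})" by (intro card_mono) (use assms in auto)
  moreover have "inj_on (elt A) {1..i}"
    using elt_image(2)[OF assms(1) refl] by (rule inj_on_subset) (use assms in auto)
  ultimately show "i \<le> card (A \<inter> {..m})" by (simp add: card_image)
next
  assume i: "i \<le> card (A \<inter> {..m})"
  show "elt A i \<le> m"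
  proof (rule ccontr)
    assume gt: "\<not> elt A i \<le> m"
    have "A \<inter> {..m} \<subseteq> elt A ` {1..<i}"
    proof
      fix x assume x: "x \<in> A \<inter> {..m}"
      then obtain j where j: "x = elt A j" "1 \<le> j" "j \<le> card A"
        using elt_image(1)[OF assms(1) refl] by force
      have "\<not> i < j" using elt_less[of A i j] j x gt assms by auto
      moreover have "j \<noteq> i" using j x gt by auto
      ultimately have "j < i" by simp
      then show "x \<in> elt A ` {1..<i}" using j by auto
    qed
    then have "card (A \<inter> {..m}) \<le> card (elt A ` {1..<i})" by (intro card_mono) auto
    also have "\<dots> \<le> card {1..<i}" by (rule card_image_le) simp
    finally show False using i assms by simp
  qed
qed

text \<open>Comparing sorted subsets entrywise is the same as comparing how many elements lie below each
  threshold.  All later arguments on the order use this form.\<close>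

lemma ple_iff_count:
  assumes "finite A" "finite B" "card A = j" "card B = j"
  shows "ple j A B \<longleftrightarrow> (\<forall>m. card (B \<inter> {..m}) \<le> card (A \<inter> {..m}))"
proof
  assume le: "ple j A B"
  show "\<forall>m. card (B \<inter> {..m}) \<le> card (A \<inter> {..m})"
  proof
    fix m
    let ?c = "card (B \<inter> {..m})"
    show "?c \<le> card (A \<inter> {..m})"
    proof (cases "?c = 0")
      case False
      have cj: "?c \<le> j" using assms by (metis card_mono inf_le1)
      have "elt B ?c \<le> m" using elt_le_iff[of B ?c m] False cj assms by simp
      moreover have "?c \<in> {1..j}" using False cj unfolding atLeastAtMost_iff by linarith
      then have "elt A ?c \<le> elt B ?c" using le unfolding ple_def by blast
      ultimately have "elt A ?c \<le> m" by simp
      then show ?thesis using elt_le_iff[of A ?c m] False cj assms by simp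
    qed simp
  qed
next
  assume c: "\<forall>m. card (B \<inter> {..m}) \<le> card (A \<inter> {..m})"
  show "ple j A B" unfolding ple_def
  proof
    fix i assume i: "i \<in> {1..j}"
    then have "i \<le> card (B \<inter> {..elt B i})" using elt_le_iff[of B i "elt B i"] assms by simp
    then have "i \<le> card (A \<inter> {..elt B i})" using c le_trans by blast
    then show "elt A i \<le> elt B i" using elt_le_iff[of A i "elt B i"] i assms by simp
  qed
qed

lemma ple_refl: "ple j A A" by (simp add: ple_def)

lemma ple_trans: "ple j A B \<Longrightarrow> ple j B C \<Longrightarrow> ple j A C"
  unfolding ple_def using le_trans by blast

lemma ple_antisym:
  assumes "finite A" "finite B" "card A = j" "card B = j" "ple j A B" "ple j B A"
  shows "A = B"
proof -
  have "elt A ` {1..j} = elt B ` {1..j}"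
    using assms(5,6) by (intro image_cong) (auto simp: ple_def intro: antisym)
  then show ?thesis using elt_image(1) assms by metis
qed

lemma card_take_sorted:
  fixes S :: "nat set"
  assumes "finite S"
  shows "card (set (take i (sorted_list_of_set S)) \<inter> {..m}) = min i (card (S \<inter> {..m}))"
proof -
  have eq: "set (take i (sorted_list_of_set S)) = elt S ` {1..min i (card S)}"
  proof -
    have "set (take i (sorted_list_of_set S)) = (!) (sorted_list_of_set S) ` {..<min i (card S)}"
      using nth_image[of "min i (card S)" "sorted_list_of_set S"] assms
      by (simp add: lessThan_atLeast0 min_def)
    moreover have "{1..min i (card S)} = Suc ` {..<min i (card S)}"
      by (simp add: image_Suc_lessThan)
    ultimately show ?thesis by (simp add: image_image elt_def)
  qed
  have "elt S ` {1..min i (card S)} \<inter> {..m} = elt S ` {1..min i (card (S \<inter> {..m}))}"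
  proof -
    have "card (S \<inter> {..m}) \<le> card S" using assms by (intro card_mono) auto
    then have "{j \<in> {1..min i (card S)}. elt S j \<le> m} = {1..min i (card (S \<inter> {..m}))}"
      using elt_le_iff[OF assms] by auto
    moreover have "elt S ` {1..min i (card S)} \<inter> {..m} = elt S ` {j \<in> {1..min i (card S)}. elt S j \<le> m}"
      by auto
    ultimately show ?thesis by simp
  qed
  moreover have "inj_on (elt S) {1..min i (card (S \<inter> {..m}))}"
  proof -
    have "card (S \<inter> {..m}) \<le> card S" using assms by (intro card_mono) auto
    then show ?thesis using elt_image(2)[OF assms refl] by (rule_tac inj_on_subset) auto
  qed
  ultimately show ?thesis using eq by (simp add: card_image)
qed

lemma ksubsetsD:
  assumes "A \<in> ksubsets k n"
  shows "A \<subseteq> {1..n}" "card A = k" "finite A"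
  using assms finite_subset[of A "{1..n}"] by (auto simp: ksubsets_def)

lemma permutes_image_card:
  assumes "w permutes {1..n}" "j \<le> n"
  shows "card (w ` {1..j}) = j" "w ` {1..j} \<subseteq> {1..n}" "w ` {1..j} \<in> ksubsets j n"
proof -
  show c: "card (w ` {1..j}) = j" 
    using card_image[OF inj_on_subset[OF permutes_inj[OF assms(1)]]] by fastforce
  show s: "w ` {1..j} \<subseteq> {1..n}" using permutes_image[OF assms(1)] assms(2) by force
  show "w ` {1..j} \<in> ksubsets j n" using c s by (simp add: ksubsets_def)
qed


section \<open>Positroids from intervals of k-subsets\<close>

text \<open>The permutation \<open>u\<close> lists \<open>a\<close>, the rest of \<open>\<beta>\<close>, and the complement of \<open>\<beta>\<close>, the last two in
  increasing order.  The conditions of \<open>u \<le> w\<close> at \<open>j = 1\<close> and \<open>j = k\<close> imply those at all other \<open>j\<close>,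
  because each initial set \<open>u ` {1..j}\<close> consists of the smallest elements still available.\<close>

lemma exists_lower_perm:
  assumes "\<beta> \<in> ksubsets k n" "a \<in> \<beta>" "k \<le> n"
  obtains u where "u permutes {1..n}" "u ` {1..k} = \<beta>" "u 1 = a"
    "\<And>w. w permutes {1..n} \<Longrightarrow> bruhat_le n u w \<longleftrightarrow> ple k \<beta> (w ` {1..k}) \<and> a \<le> w 1"
proof -
  note b = ksubsetsD[OF assms(1)]
  have k: "1 \<le> k" using b assms(2) by (metis card_gt_0_iff empty_iff less_eq_Suc_le One_nat_def)
  define xs where "xs = a # sorted_list_of_set (\<beta> - {a}) @ sorted_list_of_set ({1..n} - \<beta>)"
  have card_ba: "card (\<beta> - {a}) = k - 1" using b assms(2) by simp
  have card_c: "card ({1..n} - \<beta>) = n - k" using b by (simp add: card_Diff_subset)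
  have len: "length xs = n" using card_ba card_c k assms(3) by (simp add: xs_def)
  have dist: "distinct xs" using b assms(2) by (auto simp: xs_def)
  have set_xs: "set xs = {1..n}" using b assms(2) by (auto simp: xs_def)
  define u where "u = (\<lambda>i. if i \<in> {1..n} then xs ! (i - 1) else i)"
  have u_img: "u ` {1..j} = set (take j xs)" if "j \<le> n" for j
  proof -
    have "{1..j} = Suc ` {..<j}" by (simp add: image_Suc_lessThan)
    moreover have "u (Suc i) = xs ! i" if "i < j" for i using that \<open>j \<le> n\<close> by (simp add: u_def)
    ultimately have "u ` {1..j} = (!) xs ` {..<j}" by (force simp: image_image)
    also have "\<dots> = set (take j xs)" using that len nth_image[of j xs] by (simp add: lessThan_atLeast0)
    finally show ?thesis .
  qed
  have perm: "u permutes {1..n}"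
  proof (rule bij_imp_permutes)
    have "u ` {1..n} = {1..n}" using u_img[of n] len set_xs by simp
    then show "bij_betw u {1..n} {1..n}" by (simp add: bij_betw_def eq_card_imp_inj_on)
  qed (auto simp: u_def)
  have u1: "u 1 = a" using k assms(3) by (simp add: u_def xs_def)
  have img_le: "u ` {1..j} = insert a (set (take (j - 1) (sorted_list_of_set (\<beta> - {a}))))"
    if "1 \<le> j" "j \<le> k" for j
    using that u_img[of j] card_ba assms(3) by (cases j) (auto simp: xs_def)
  have img_ge: "u ` {1..j} = \<beta> \<union> set (take (j - k) (sorted_list_of_set ({1..n} - \<beta>)))"
    if "k \<le> j" "j \<le> n" for j
    using that u_img[of j] card_ba k b assms(2) by (cases j) (auto simp: xs_def)
  have ub: "u ` {1..k} = \<beta>" using img_ge[of k] assms(3) by simp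
  show ?thesis
  proof (rule that[OF perm ub u1])
    fix w assume w: "w permutes {1..n}"
    let ?\<alpha> = "w ` {1..k}"
    show "bruhat_le n u w \<longleftrightarrow> ple k \<beta> ?\<alpha> \<and> a \<le> w 1"
    proof
      assume le: "bruhat_le n u w"
      have "ple k \<beta> ?\<alpha>" using le ub k assms(3) by (auto simp: bruhat_le_def perm_proj_def)
      moreover have "ple 1 {a} {w 1}" using le u1 k assms(3) by (auto simp: bruhat_le_def perm_proj_def dest!: bspec[where x=1])
      ultimately show "ple k \<beta> ?\<alpha> \<and> a \<le> w 1" by (simp add: ple_def elt_def)
    next
      assume h: "ple k \<beta> ?\<alpha> \<and> a \<le> w 1"
      note al = permutes_image_card[OF w assms(3)]
      have cnt: "card (?\<alpha> \<inter> {..m}) \<le> card (\<beta> \<inter> {..m})" for m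
        using h ple_iff_count[of \<beta> ?\<alpha> k] b al by auto
      show "bruhat_le n u w" unfolding bruhat_le_def perm_proj_def
      proof
        fix j assume j: "j \<in> {1..n}"
        have cw: "card (w ` {1..j}) = j" and cu: "card (u ` {1..j}) = j"
          using permutes_image_card w perm j by auto
        have "card (w ` {1..j} \<inter> {..m}) \<le> card (u ` {1..j} \<inter> {..m})" for m
        proof (cases "j \<le> k")
          case True
          let ?S = "set (take (j - 1) (sorted_list_of_set (\<beta> - {a})))"
          have S: "card (?S \<inter> {..m}) = min (j - 1) (card ((\<beta> - {a}) \<inter> {..m}))"
            using card_take_sorted[of "\<beta> - {a}" "j - 1" m] b by simp
          have aS: "a \<notin> ?S" using b by (auto dest: in_set_takeD)
          have u_eq: "u ` {1..j} = insert a ?S" using img_le j True by auto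
          have "card (w ` {1..j} \<inter> {..m}) \<le> card (?\<alpha> \<inter> {..m})"
            using True by (intro card_mono) auto
          then have w1: "card (w ` {1..j} \<inter> {..m}) \<le> card (\<beta> \<inter> {..m})" using cnt le_trans by blast
          show ?thesis
          proof (cases "a \<le> m")
            case True
            have "card (u ` {1..j} \<inter> {..m}) = 1 + card (?S \<inter> {..m})"
              using u_eq aS True by simp
            moreover have "card (\<beta> \<inter> {..m}) = 1 + card ((\<beta> - {a}) \<inter> {..m})"
            proof -
              have "\<beta> \<inter> {..m} = insert a ((\<beta> - {a}) \<inter> {..m})" using assms(2) True by auto
              then show ?thesis using b by simp
            qed
            moreover have "card (w ` {1..j} \<inter> {..m}) \<le> j" using cw card_mono[of "w ` {1..j}" "w ` {1..j} \<inter> {..m}"] by auto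
            ultimately show ?thesis using S w1 j by auto
          next
            case False
            have "u ` {1..j} \<inter> {..m} = ?S \<inter> {..m}" using u_eq False by auto
            moreover have "\<beta> \<inter> {..m} = (\<beta> - {a}) \<inter> {..m}" using False by auto
            \<comment> \<open>The value \<open>w 1 \<ge> a > m\<close> is not counted.\<close>
            moreover have "card (w ` {1..j} \<inter> {..m}) \<le> j - 1"
            proof -
              have "x \<in> {2..j}" if "x \<in> {1..j}" "w x \<le> m" for x
                using that h False by (cases "x = 1") auto
              then have "w ` {1..j} \<inter> {..m} \<subseteq> w ` {2..j}" by auto
              then have "card (w ` {1..j} \<inter> {..m}) \<le> card (w ` {2..j})" by (intro card_mono) auto
              also have "\<dots> \<le> card {2..j}" by (rule card_image_le) simp
              finally show ?thesis by simp
            qed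
            ultimately show ?thesis using S w1 by simp
          qed
        next
          case False
          let ?S = "set (take (j - k) (sorted_list_of_set ({1..n} - \<beta>)))"
          have S: "card (?S \<inter> {..m}) = min (j - k) (card (({1..n} - \<beta>) \<inter> {..m}))"
            using card_take_sorted[of "{1..n} - \<beta>" "j - k" m] by simp
          have disj: "\<beta> \<inter> ?S = {}" by (auto dest: in_set_takeD)
          have u_eq: "u ` {1..j} = \<beta> \<union> ?S" using img_ge j False by auto
          have cu': "card (u ` {1..j} \<inter> {..m}) = card (\<beta> \<inter> {..m}) + card (?S \<inter> {..m})"
            unfolding u_eq Int_Un_distrib2 using b disj by (intro card_Un_disjoint) auto
          have comp: "card ({1..n} \<inter> {..m}) = card (\<beta> \<inter> {..m}) + card (({1..n} - \<beta>) \<inter> {..m})"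
          proof -
            have "{1..n} \<inter> {..m} = (\<beta> \<inter> {..m}) \<union> (({1..n} - \<beta>) \<inter> {..m})" using b by auto
            then show ?thesis using b by (metis card_Un_disjoint finite_Int Diff_disjoint Int_assoc Int_empty_left Int_left_commute finite_Diff finite_atLeastAtMost)
          qed
          have w2: "card (w ` {1..j} \<inter> {..m}) \<le> card ({1..n} \<inter> {..m})"
            using permutes_image_card(2)[OF w, of j] j by (intro card_mono Int_mono) auto
          have "w ` {1..j} \<inter> {..m} \<subseteq> (?\<alpha> \<inter> {..m}) \<union> w ` {k+1..j}"
            by force
          then have "card (w ` {1..j} \<inter> {..m}) \<le> card ((?\<alpha> \<inter> {..m}) \<union> w ` {k+1..j})"
            by (intro card_mono) auto
          also have "\<dots> \<le> card (?\<alpha> \<inter> {..m}) + card (w ` {k+1..j})" by (rule card_Un_le)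
          also have "card (w ` {k+1..j}) \<le> card {k+1..j}" by (rule card_image_le) simp
          finally have "card (w ` {1..j} \<inter> {..m}) \<le> card (\<beta> \<inter> {..m}) + (j - k)"
            using cnt[of m] by simp
          then show ?thesis unfolding cu' S using w2 comp by linarith
        qed
        then show "ple j (u ` {1..j}) (w ` {1..j})"
          using ple_iff_count[of "u ` {1..j}" "w ` {1..j}" j] cu cw by simp
      qed
    qed
  qed
qed

text \<open>The order-reversing permutation \<open>i \<mapsto> n + 1 - i\<close> of \<open>{1..n}\<close>, extended by the identity so that
  it satisfies \<open>permutes\<close>.\<close>

definition reversal :: "nat \<Rightarrow> nat \<Rightarrow> nat" where
  "reversal n i = (if i \<in> {1..n} then n + 1 - i else i)"

lemma reversal_reversal [simp]: "reversal n (reversal n i) = i"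
  by (auto simp: reversal_def)

lemma reversal_permutes: "reversal n permutes {1..n}"
proof (rule bij_imp_permutes)
  show "bij_betw (reversal n) {1..n} {1..n}"
    by (rule bij_betwI[where g="reversal n"]) (auto simp: reversal_def)
qed (auto simp: reversal_def)

lemma reversal_image_ksubsets:
  assumes "A \<in> ksubsets k n"
  shows "reversal n ` A \<in> ksubsets k n"
proof -
  have "inj (reversal n)" by (metis injI reversal_reversal)
  then have "card (reversal n ` A) = k" using ksubsetsD[OF assms] by (metis card_image inj_on_subset subset_UNIV)
  moreover have "reversal n ` A \<subseteq> {1..n}" using ksubsetsD[OF assms] by (auto simp: reversal_def)
  ultimately show ?thesis by (simp add: ksubsets_def)
qed

lemma ple_reversal:
  assumes A: "A \<in> ksubsets j n" and B: "B \<in> ksubsets j n" and le: "ple j A B"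
  shows "ple j (reversal n ` B) (reversal n ` A)"
proof -
  let ?r = "reversal n"
  have inj: "inj ?r" by (metis injI reversal_reversal)
  have cnt: "card (?r ` C \<inter> {..m}) = j - card (C \<inter> {..n - m})" if "C \<in> ksubsets j n" for C m
  proof -
    note c = ksubsetsD[OF that]
    have "?r x \<le> m \<longleftrightarrow> \<not> x \<le> n - m" if "x \<in> C" for x
      using that c(1) by (auto simp: reversal_def)
    then have "?r ` C \<inter> {..m} = ?r ` (C - {..n - m})" by auto
    then have "card (?r ` C \<inter> {..m}) = card (C - {..n - m})"
      using inj by (metis card_image inj_on_subset subset_UNIV)
    then show ?thesis using c by (simp add: card_Diff_subset_Int)
  qed
  have "card (B \<inter> {..m}) \<le> card (A \<inter> {..m})" for m
    using le ple_iff_count[of A B j] ksubsetsD[OF A] ksubsetsD[OF B] by auto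
  then have "card (?r ` A \<inter> {..m}) \<le> card (?r ` B \<inter> {..m})" for m
    using cnt[OF A] cnt[OF B] by (simp add: diff_le_mono2)
  then show ?thesis
    using ple_iff_count[of "?r ` B" "?r ` A" j] ksubsetsD[OF reversal_image_ksubsets[OF A]]
      ksubsetsD[OF reversal_image_ksubsets[OF B]] by auto
qed

lemma ple_reversal_iff:
  assumes A: "A \<in> ksubsets j n" and B: "B \<in> ksubsets j n"
  shows "ple j (reversal n ` B) (reversal n ` A) \<longleftrightarrow> ple j A B"
proof -
  have "reversal n ` reversal n ` C = C" for C by (simp add: image_image)
  then show ?thesis
    using ple_reversal[OF A B] ple_reversal[OF reversal_image_ksubsets[OF B] reversal_image_ksubsets[OF A]]
    by auto
qed

text \<open>The mirror image of \<open>exists_lower_perm\<close> under \<open>reversal\<close>.\<close>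

lemma exists_upper_perm:
  assumes "\<gamma> \<in> ksubsets k n" "b \<in> \<gamma>" "k \<le> n"
  obtains v where "v permutes {1..n}"
    "\<And>w. w permutes {1..n} \<Longrightarrow> bruhat_le n w v \<longleftrightarrow> ple k (w ` {1..k}) \<gamma> \<and> w 1 \<le> b"
proof -
  let ?r = "reversal n"
  obtain u where u: "u permutes {1..n}"
    "\<And>w. w permutes {1..n} \<Longrightarrow> bruhat_le n u w \<longleftrightarrow> ple k (?r ` \<gamma>) (w ` {1..k}) \<and> ?r b \<le> w 1"
    using exists_lower_perm[OF reversal_image_ksubsets[OF assms(1)] imageI[OF assms(2)] assms(3)]
    by metis
  have k: "1 \<le> k" using ksubsetsD[OF assms(1)] assms(2)
    by (metis card_gt_0_iff empty_iff less_eq_Suc_le One_nat_def)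
  show ?thesis
  proof (rule that[of "?r \<circ> u"])
    show "?r \<circ> u permutes {1..n}" using u(1) reversal_permutes by (rule permutes_compose)
    fix w assume w: "w permutes {1..n}"
    have rw: "?r \<circ> w permutes {1..n}" using w reversal_permutes by (rule permutes_compose)
    have "bruhat_le n w (?r \<circ> u) \<longleftrightarrow> bruhat_le n u (?r \<circ> w)"
      unfolding bruhat_le_def perm_proj_def
    proof (rule ball_cong[OF refl])
      fix j assume "j \<in> {1..n}"
      then have "u ` {1..j} \<in> ksubsets j n" "w ` {1..j} \<in> ksubsets j n"
        using permutes_image_card(3) u(1) w by auto
      from ple_reversal_iff[OF this(1) reversal_image_ksubsets[OF this(2)]]
      show "ple j (w ` {1..j}) ((?r \<circ> u) ` {1..j}) = ple j (u ` {1..j}) ((?r \<circ> w) ` {1..j})"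
        by (simp add: image_image image_comp)
    qed
    also have "\<dots> \<longleftrightarrow> ple k (?r ` \<gamma>) (?r ` w ` {1..k}) \<and> ?r b \<le> ?r (w 1)"
      using u(2)[OF rw] by (simp add: image_comp)
    also have "\<dots> \<longleftrightarrow> ple k (w ` {1..k}) \<gamma> \<and> w 1 \<le> b"
    proof -
      have "w 1 \<in> {1..n}" using permutes_in_image[OF w, of 1] k assms(3) by auto
      moreover have "b \<in> {1..n}" using assms ksubsetsD by blast
      ultimately have "?r b \<le> ?r (w 1) \<longleftrightarrow> w 1 \<le> b" by (auto simp: reversal_def)
      then show ?thesis
        using ple_reversal_iff[OF permutes_image_card(3)[OF w assms(3)] assms(1)] by simp
    qed
    finally show "bruhat_le n w (?r \<circ> u) \<longleftrightarrow> ple k (w ` {1..k}) \<gamma> \<and> w 1 \<le> b" .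
  qed
qed

lemma bruhat_le_trans: "bruhat_le n u v \<Longrightarrow> bruhat_le n v w \<Longrightarrow> bruhat_le n u w"
  unfolding bruhat_le_def using ple_trans by blast

lemma positroid_interval_meet:
  assumes "\<beta> \<in> ksubsets k n" "\<gamma> \<in> ksubsets k n" "a \<in> \<beta>" "b \<in> \<gamma>" "k \<le> n"
    and M_def: "M = {\<alpha> \<in> pinterval k n \<beta> \<gamma>. \<alpha> \<inter> {a..b} \<noteq> {}}" and "M \<noteq> {}"
  shows "positroid k n M"
proof -
  have k: "1 \<le> k" using ksubsetsD[OF assms(1)] assms(3)
    by (metis card_gt_0_iff empty_iff less_eq_Suc_le One_nat_def)
  obtain u where u: "u permutes {1..n}"
    "\<And>w. w permutes {1..n} \<Longrightarrow> bruhat_le n u w \<longleftrightarrow> ple k \<beta> (w ` {1..k}) \<and> a \<le> w 1"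
    using exists_lower_perm[OF assms(1,3,5)] by metis
  obtain v where v: "v permutes {1..n}"
    "\<And>w. w permutes {1..n} \<Longrightarrow> bruhat_le n w v \<longleftrightarrow> ple k (w ` {1..k}) \<gamma> \<and> w 1 \<le> b"
    using exists_upper_perm[OF assms(2,4,5)] by metis
  have interval: "bruhat_interval n u v =
      {w. w permutes {1..n} \<and> w ` {1..k} \<in> pinterval k n \<beta> \<gamma> \<and> w 1 \<in> {a..b}}"
    using u(2) v(2) permutes_image_card(3) assms(5)
    by (auto simp: bruhat_interval_def pinterval_def)
  have img: "perm_proj k ` bruhat_interval n u v = M"
  proof
    show "perm_proj k ` bruhat_interval n u v \<subseteq> M"
      using k by (force simp: interval M_def perm_proj_def)
    show "M \<subseteq> perm_proj k ` bruhat_interval n u v"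
    proof
      fix \<alpha> assume \<alpha>: "\<alpha> \<in> M"
      then obtain x where x: "x \<in> \<alpha>" "x \<in> {a..b}" unfolding M_def by blast
      have "\<alpha> \<in> ksubsets k n" using \<alpha> by (simp add: M_def pinterval_def)
      then obtain w where "w permutes {1..n}" "w ` {1..k} = \<alpha>" "w 1 = x"
        using exists_lower_perm x(1) assms(5) by metis
      then show "\<alpha> \<in> perm_proj k ` bruhat_interval n u v"
        using \<alpha> x by (auto simp: interval M_def perm_proj_def image_iff intro!: exI[of _ w])
    qed
  qed
  moreover have "bruhat_le n u v"
  proof -
    obtain w where "w \<in> bruhat_interval n u v" using img \<open>M \<noteq> {}\<close> by auto
    then show ?thesis using bruhat_le_trans by (auto simp: bruhat_interval_def)
  qed
  moreover have "M \<subseteq> ksubsets k n" by (auto simp: M_def pinterval_def)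
  ultimately show ?thesis using u(1) v(1) unfolding positroid_def by metis
qed

lemma positroid_pinterval:
  assumes "\<beta> \<in> ksubsets k n" "\<gamma> \<in> ksubsets k n" "ple k \<beta> \<gamma>" "1 \<le> k" "k \<le> n"
  shows "positroid k n (pinterval k n \<beta> \<gamma>)"
proof (rule positroid_interval_meet[OF assms(1,2) _ _ assms(5)])
  note b = ksubsetsD[OF assms(1)] and c = ksubsetsD[OF assms(2)]
  show "elt \<beta> 1 \<in> \<beta>" "elt \<gamma> k \<in> \<gamma>" using elt_in b c assms(4) by auto
  show "pinterval k n \<beta> \<gamma> = {\<alpha> \<in> pinterval k n \<beta> \<gamma>. \<alpha> \<inter> {elt \<beta> 1..elt \<gamma> k} \<noteq> {}}"
  proof -
    have "\<alpha> \<inter> {elt \<beta> 1..elt \<gamma> k} \<noteq> {}" if \<alpha>: "\<alpha> \<in> pinterval k n \<beta> \<gamma>" for \<alpha>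
    proof -
      have a: "\<alpha> \<in> ksubsets k n" "ple k \<beta> \<alpha>" "ple k \<alpha> \<gamma>" using \<alpha> by (auto simp: pinterval_def)
      have "elt \<beta> 1 \<le> elt \<alpha> 1" "elt \<alpha> k \<le> elt \<gamma> k" using a assms(4) by (auto simp: ple_def)
      moreover have "elt \<alpha> 1 \<le> elt \<alpha> k"
        using elt_less[of \<alpha> 1 k] ksubsetsD[OF a(1)] assms(4) by (cases "k = 1") auto
      moreover have "elt \<alpha> 1 \<in> \<alpha>" using elt_in ksubsetsD[OF a(1)] assms(4) by auto
      ultimately show ?thesis using order_trans by (metis IntI atLeastAtMost_iff empty_iff)
    qed
    then show ?thesis by auto
  qed
  show "pinterval k n \<beta> \<gamma> \<noteq> {}" using assms ple_refl by (auto simp: pinterval_def)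
qed

section \<open>Families with the symmetric exchange property\<close>

text \<open>The symmetric exchange property of the bases of a matroid.  Unlike a matroid, the family is
  allowed to be empty.\<close>

definition symmetric_exchange :: "'a set set \<Rightarrow> bool" where
  "symmetric_exchange M \<longleftrightarrow> (\<forall>B\<in>M. \<forall>C\<in>M. \<forall>y\<in>C - B. \<exists>x\<in>B - C.
     insert y (B - {x}) \<in> M \<and> insert x (C - {y}) \<in> M)"

lemma symmetric_exchangeE:
  assumes "symmetric_exchange M" "B \<in> M" "C \<in> M" "y \<in> C" "y \<notin> B"
  obtains x where "x \<in> B" "x \<notin> C" "insert y (B - {x}) \<in> M" "insert x (C - {y}) \<in> M"
  using assms unfolding symmetric_exchange_def by (metis DiffD1 DiffD2 DiffI)

text \<open>The greedy principle: a member of minimal weight has at least as many elements of weight at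
  most \<open>m\<close> as any other member.  Among counterexamples \<open>C\<close> one takes the closest to \<open>\<mu>\<close>; minimality
  of \<open>\<mu>\<close> forces the element that enters \<open>C\<close> to be no heavier than the one that leaves, so that the
  exchanged set is a counterexample closer to \<open>\<mu>\<close>.\<close>

lemma min_weight_dominates:
  fixes f :: "'a \<Rightarrow> 'b::linordered_ab_group_add"
  assumes exch: "symmetric_exchange M" and fin: "\<And>B. B \<in> M \<Longrightarrow> finite B"
    and \<mu>: "\<mu> \<in> M" and min: "\<And>B. B \<in> M \<Longrightarrow> sum f \<mu> \<le> sum f B"
    and C: "C \<in> M"
  shows "card (C \<inter> {x. f x \<le> m}) \<le> card (\<mu> \<inter> {x. f x \<le> m})"
  using C
proof (induction "card (C - \<mu>)" arbitrary: C rule: less_induct)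
  case less
  let ?S = "{x. f x \<le> m}"
  show ?case
  proof (cases "C \<inter> ?S \<subseteq> \<mu>")
    case True
    then show ?thesis using fin[OF \<mu>] by (intro card_mono) auto
  next
    case False
    then obtain y where y: "y \<in> C" "f y \<le> m" "y \<notin> \<mu>" by auto
    obtain x where x: "x \<in> \<mu>" "x \<notin> C" "insert y (\<mu> - {x}) \<in> M" "insert x (C - {y}) \<in> M"
      using symmetric_exchangeE[OF exch \<mu> less.prems y(1,3)] by metis
    have "sum f \<mu> \<le> sum f (insert y (\<mu> - {x}))" by (rule min[OF x(3)])
    also have "\<dots> = f y + sum f (\<mu> - {x})" using fin[OF \<mu>] y by simp
    finally have "f x \<le> f y" using fin[OF \<mu>] x(1) by (simp add: sum_diff1)
    then have xm: "f x \<le> m" using y by simp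
    let ?C = "insert x (C - {y})"
    have "?C - \<mu> = (C - \<mu>) - {y}" using x by auto
    then have "card (?C - \<mu>) < card (C - \<mu>)"
      using y fin[OF less.prems] by (metis DiffI card_Diff1_less finite_Diff)
    then have "card (?C \<inter> ?S) \<le> card (\<mu> \<inter> ?S)" by (rule less.hyps[OF _ x(4)])
    moreover have "?C \<inter> ?S = insert x ((C \<inter> ?S) - {y})" using xm by auto
    then have "card (?C \<inter> ?S) = card (C \<inter> ?S)"
      using x y fin[OF less.prems] by (simp add: card_Suc_Diff1 del: card_Diff_singleton card_Diff_insert)
    ultimately show ?thesis by simp
  qed
qed

text \<open>If no member has more than \<open>t\<close> elements in \<open>L\<close>, and \<open>\<alpha>\<close> and \<open>\<beta>\<close> both attain this bound, then
  \<open>\<alpha> \<inter> L\<close> can be replaced by \<open>\<beta> \<inter> L\<close>: in matroid terms, \<open>\<alpha> - L\<close> is a basis of the contraction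
  by \<open>L\<close>, and \<open>\<beta> \<inter> L\<close> spans \<open>L\<close>.\<close>

lemma exchange_spanning_part:
  assumes exch: "symmetric_exchange M" and fin: "\<And>B. B \<in> M \<Longrightarrow> finite B"
    and bound: "\<And>B. B \<in> M \<Longrightarrow> card (B \<inter> L) \<le> t"
    and \<beta>: "\<beta> \<in> M" "card (\<beta> \<inter> L) = t"
    and \<alpha>: "\<alpha> \<in> M" "card (\<alpha> \<inter> L) = t"
  shows "(\<beta> \<inter> L) \<union> (\<alpha> - L) \<in> M"
  using \<alpha>
proof (induction "card (\<beta> \<inter> L - \<alpha>)" arbitrary: \<alpha> rule: less_induct)
  case less
  show ?case
  proof (cases "\<beta> \<inter> L \<subseteq> \<alpha>")
    case True
    then have "\<beta> \<inter> L = \<alpha> \<inter> L"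
      using \<beta> less.prems fin[OF less.prems(1)] by (intro card_subset_eq) auto
    then have "(\<beta> \<inter> L) \<union> (\<alpha> - L) = \<alpha>" by auto
    then show ?thesis using less.prems by simp
  next
    case False
    then obtain y where y: "y \<in> \<beta>" "y \<in> L" "y \<notin> \<alpha>" by auto
    obtain x where x: "x \<in> \<alpha>" "x \<notin> \<beta>" "insert y (\<alpha> - {x}) \<in> M"
      using symmetric_exchangeE[OF exch less.prems(1) \<beta>(1) y(1,3)] by metis
    let ?A = "insert y (\<alpha> - {x})"
    have xL: "x \<in> L"
    proof (rule ccontr)
      assume "x \<notin> L"
      then have "?A \<inter> L = insert y (\<alpha> \<inter> L)" using y by auto
      then show False using bound[OF x(3)] y less.prems fin[OF less.prems(1)] by simp
    qed
    have "\<beta> \<inter> L - ?A = (\<beta> \<inter> L - \<alpha>) - {y}" using x by auto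
    then have "card (\<beta> \<inter> L - ?A) < card (\<beta> \<inter> L - \<alpha>)"
      using y fin[OF \<beta>(1)] by (metis DiffI IntI card_Diff1_less finite_Diff finite_Int)
    moreover have "card (?A \<inter> L) = t"
    proof -
      have "?A \<inter> L = insert y ((\<alpha> \<inter> L) - {x})" using y by auto
      then show ?thesis using less.prems x xL y fin[OF less.prems(1)] by (simp add: card_Suc_Diff1 del: card_Diff_singleton card_Diff_insert)
    qed
    ultimately have "(\<beta> \<inter> L) \<union> (?A - L) \<in> M" using less.hyps x(3) by blast
    moreover have "?A - L = \<alpha> - L" using y xL by auto
    ultimately show ?thesis by simp
  qed
qed

lemma finite_ksubsets: "finite (ksubsets k n)"
  by (rule finite_subset[of _ "Pow {1..n}"]) (auto simp: ksubsets_def)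

lemma ple_least_exists:
  assumes exch: "symmetric_exchange M" and M: "M \<subseteq> ksubsets k n" "M \<noteq> {}"
  obtains \<mu> where "\<mu> \<in> M" "\<And>C. C \<in> M \<Longrightarrow> ple k \<mu> C"
proof -
  have fin: "finite B" if "B \<in> M" for B using that M(1) ksubsetsD(3) by blast
  have finM: "finite M" using M finite_ksubsets finite_subset by blast
  obtain \<mu> where \<mu>: "\<mu> \<in> M" "\<And>B. B \<in> M \<Longrightarrow> sum int \<mu> \<le> sum int B"
    using ex_is_arg_min_if_finite[OF finM M(2), of "sum int"]
    by (auto simp: is_arg_min_linorder)
  show ?thesis
  proof (rule that[OF \<mu>(1)])
    fix C assume C: "C \<in> M"
    have "card (C \<inter> {..m}) \<le> card (\<mu> \<inter> {..m})" for m
    proof -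
      have "{x. int x \<le> int m} = {..m}" by auto
      then show ?thesis
        using min_weight_dominates[OF exch fin \<mu> C, of "int m"] by simp
    qed
    then show "ple k \<mu> C" using ple_iff_count[of \<mu> C k] M(1) \<mu>(1) C ksubsetsD
      by (metis subsetD)
  qed
qed

lemma ple_greatest_exists:
  assumes exch: "symmetric_exchange M" and M: "M \<subseteq> ksubsets k n" "M \<noteq> {}"
  obtains \<mu> where "\<mu> \<in> M" "\<And>C. C \<in> M \<Longrightarrow> ple k C \<mu>"
proof -
  let ?f = "\<lambda>x. - int x"
  have fin: "finite B" if "B \<in> M" for B using that M(1) ksubsetsD(3) by blast
  have finM: "finite M" using M finite_ksubsets finite_subset by blast
  obtain \<mu> where \<mu>: "\<mu> \<in> M" "\<And>B. B \<in> M \<Longrightarrow> sum ?f \<mu> \<le> sum ?f B"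
    using ex_is_arg_min_if_finite[OF finM M(2), of "sum ?f"]
    by (auto simp: is_arg_min_linorder)
  show ?thesis
  proof (rule that[OF \<mu>(1)])
    fix C assume C: "C \<in> M"
    have "card (\<mu> \<inter> {..m}) \<le> card (C \<inter> {..m})" for m
    proof -
      \<comment> \<open>The elements greater than \<open>m\<close> are those of weight at most \<open>- (m + 1)\<close>.\<close>
      let ?U = "{x. ?f x \<le> ?f (Suc m)}"
      have split: "card (B \<inter> {..m}) = k - card (B \<inter> ?U)" if "B \<in> M" for B
      proof -
        have B: "finite B" "card B = k" using that M(1) ksubsetsD by blast+
        have "B \<inter> {..m} = B - B \<inter> ?U" by auto
        then show ?thesis using B by (simp add: card_Diff_subset)
      qed
      have "card (C \<inter> ?U) \<le> card (\<mu> \<inter> ?U)"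
        using min_weight_dominates[OF exch fin \<mu> C, of "?f (Suc m)"] by simp
      then show ?thesis using split \<mu>(1) C by (simp add: diff_le_mono2)
    qed
    then show "ple k C \<mu>" using ple_iff_count[of C \<mu> k] M(1) \<mu>(1) C ksubsetsD
      by (metis subsetD)
  qed
qed

lemma ple_sum_less:
  assumes "A \<in> ksubsets k n" "B \<in> ksubsets k n" "ple k A B" "A \<noteq> B"
  shows "sum (elt A) {1..k} < sum (elt B) {1..k}"
proof (rule sum_strict_mono_ex1)
  show "\<forall>i\<in>{1..k}. elt A i \<le> elt B i" using assms(3) by (simp add: ple_def)
  show "\<exists>i\<in>{1..k}. elt A i < elt B i"
  proof (rule ccontr)
    assume "\<not> ?thesis"
    then have "ple k B A" by (auto simp: ple_def not_less)
    then show False using ple_antisym[of A B k] assms ksubsetsD by metis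
  qed
qed simp

lemma upper_cover_exists:
  assumes "\<beta> \<in> ksubsets k n" "\<mu> \<in> ksubsets k n" "ple k \<beta> \<mu>" "\<beta> \<noteq> \<mu>"
  obtains \<beta>' where "pcovers k n \<beta> \<beta>'" "ple k \<beta>' \<mu>"
proof -
  let ?N = "{\<nu> \<in> ksubsets k n. ple k \<beta> \<nu> \<and> \<beta> \<noteq> \<nu> \<and> ple k \<nu> \<mu>}"
  have "finite ?N" using finite_ksubsets by simp
  moreover have "?N \<noteq> {}" using assms ple_refl by auto
  ultimately obtain \<nu> where \<nu>: "\<nu> \<in> ?N"
    "\<And>\<xi>. \<xi> \<in> ?N \<Longrightarrow> sum (elt \<nu>) {1..k} \<le> sum (elt \<xi>) {1..k}"
    using ex_is_arg_min_if_finite[of ?N "\<lambda>\<nu>. sum (elt \<nu>) {1..k}"]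
    by (auto simp: is_arg_min_linorder)
  have "False" if "\<xi> \<in> ksubsets k n" "ple k \<beta> \<xi>" "\<beta> \<noteq> \<xi>" "ple k \<xi> \<nu>" "\<xi> \<noteq> \<nu>" for \<xi>
    using ple_sum_less[of \<xi> k n \<nu>] \<nu>(2)[of \<xi>] \<nu>(1) that ple_trans[of k \<xi> \<nu> \<mu>] by auto
  then have "pcovers k n \<beta> \<nu>" using \<nu>(1) assms(1) unfolding pcovers_def by blast
  then show ?thesis using that \<nu>(1) by blast
qed

lemma lower_cover_exists:
  assumes "\<gamma> \<in> ksubsets k n" "\<mu> \<in> ksubsets k n" "ple k \<mu> \<gamma>" "\<mu> \<noteq> \<gamma>"
  obtains \<gamma>' where "pcovers k n \<gamma>' \<gamma>" "ple k \<mu> \<gamma>'"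
proof -
  let ?N = "{\<nu> \<in> ksubsets k n. ple k \<mu> \<nu> \<and> \<nu> \<noteq> \<gamma> \<and> ple k \<nu> \<gamma>}"
  have "finite ?N" using finite_ksubsets by simp
  moreover have "?N \<noteq> {}" using assms ple_refl by auto
  ultimately obtain \<nu> where \<nu>: "\<nu> \<in> ?N"
    "\<And>\<xi>. \<xi> \<in> ?N \<Longrightarrow> sum (elt \<xi>) {1..k} \<le> sum (elt \<nu>) {1..k}"
    using ex_is_arg_min_if_finite[of ?N "\<lambda>\<nu>. - int (sum (elt \<nu>) {1..k})"]
    by (auto simp: is_arg_min_linorder simp flip: of_nat_sum)
  have "False" if "\<xi> \<in> ksubsets k n" "ple k \<nu> \<xi>" "\<nu> \<noteq> \<xi>" "ple k \<xi> \<gamma>" "\<xi> \<noteq> \<gamma>" for \<xi>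
    using ple_sum_less[of \<nu> k n \<xi>] \<nu>(2)[of \<xi>] \<nu>(1) that ple_trans[of k \<mu> \<nu> \<xi>] by auto
  then have "pcovers k n \<nu> \<gamma>" using \<nu>(1) assms(1) unfolding pcovers_def by blast
  then show ?thesis using that \<nu>(1) by blast
qed


section \<open>The distinguished subsets and the family of positroids\<close>

lemma Int_lessThan_elt:
  assumes "finite A" "t < card A"
  shows "A \<inter> {..<elt A (t + 1)} = elt A ` {1..t}" "A \<inter> {elt A (t + 1)..} = elt A ` {t+1..card A}"
proof -
  have A: "A = elt A ` {1..card A}" using elt_image(1)[OF assms(1) refl] by simp
  have iff: "elt A i < elt A (t + 1) \<longleftrightarrow> i \<le> t" if "i \<in> {1..card A}" for i
  proof (cases "i \<le> t")
    case True
    then show ?thesis using elt_less[OF assms(1), of i "t + 1"] that assms by auto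
  next
    case False
    then have "elt A (t + 1) \<le> elt A i"
      using elt_less[OF assms(1), of "t + 1" i] that assms by (cases "i = t + 1") auto
    then show ?thesis using False by simp
  qed
  have "elt A ` {1..card A} \<inter> {..<elt A (t + 1)} = elt A ` {i \<in> {1..card A}. elt A i < elt A (t + 1)}"
    by auto
  also have "{i \<in> {1..card A}. elt A i < elt A (t + 1)} = {1..t}" using iff assms(2) by auto
  finally show "A \<inter> {..<elt A (t + 1)} = elt A ` {1..t}" using A by simp
  have "elt A ` {1..card A} \<inter> {elt A (t + 1)..} = elt A ` {i \<in> {1..card A}. \<not> elt A i < elt A (t + 1)}"
    by auto
  also have "{i \<in> {1..card A}. \<not> elt A i < elt A (t + 1)} = {t+1..card A}" using iff assms(2) by auto
  finally show "A \<inter> {elt A (t + 1)..} = elt A ` {t+1..card A}" using A by simp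
qed

lemma delta_not_in_Pset:
  assumes "\<beta> \<in> ksubsets k n" "\<gamma> \<in> ksubsets k n" "1 \<le> t" "t \<le> k - 1"
  shows "delta k \<beta> \<gamma> t \<notin> Pset k n \<beta> \<gamma> t"
proof -
  note b = ksubsetsD[OF assms(1)] and c = ksubsetsD[OF assms(2)]
  have "elt \<beta> i < elt \<beta> (t + 1)" if "i \<in> {1..t}" for i
    using elt_less[of \<beta> i "t + 1"] that b assms by auto
  moreover have "elt \<gamma> t < elt \<gamma> i" if "i \<in> {t+1..k}" for i
    using elt_less[of \<gamma> t i] that c assms by auto
  ultimately show ?thesis by (fastforce simp: delta_def Pset_def)
qed

text \<open>Two applications of \<open>exchange_spanning_part\<close>: first with the elements below \<open>\<beta>(t + 1)\<close>, then
  with those above \<open>\<gamma>(t)\<close>.  The interval between these two bounds may be empty.\<close>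

lemma delta_mem_of_avoiding:
  assumes exch: "symmetric_exchange M" and M: "M \<subseteq> pinterval k n \<beta> \<gamma>"
    and \<beta>: "\<beta> \<in> M" and \<gamma>: "\<gamma> \<in> M" and t: "1 \<le> t" "t \<le> k - 1"
    and \<alpha>: "\<alpha> \<in> M" "\<alpha> \<inter> {elt \<beta> (t + 1)..elt \<gamma> t} = {}"
  shows "delta k \<beta> \<gamma> t \<in> M"
proof -
  have mem: "B \<subseteq> {1..n}" "card B = k" "finite B" "ple k \<beta> B" "ple k B \<gamma>" if "B \<in> M" for B
  proof -
    have "B \<in> ksubsets k n" "ple k \<beta> B" "ple k B \<gamma>" using that M by (auto simp: pinterval_def)
    then show "B \<subseteq> {1..n}" "card B = k" "finite B" "ple k \<beta> B" "ple k B \<gamma>"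
      using ksubsetsD by blast+
  qed
  define L where "L = {..<elt \<beta> (t + 1)}"
  define U where "U = {elt \<gamma> t<..}"
  have t': "t \<in> {1..k}" "t + 1 \<in> {1..k}" using t by auto
  have finL: "finite L" by (simp add: L_def)
  have lower: "card (B \<inter> L) \<le> t" if "B \<in> M" for B
  proof (rule ccontr)
    assume gt: "\<not> ?thesis"
    have "elt \<beta> (t + 1) \<in> \<beta>" using elt_in[of \<beta> "t + 1"] mem[OF \<beta>] t by auto
    then have "elt \<beta> (t + 1) \<in> {1..n}" using mem(1)[OF \<beta>] by blast
    then have "elt \<beta> (t + 1) \<noteq> 0" by simp
    then have L: "L = {..elt \<beta> (t + 1) - 1}" by (auto simp: L_def)
    have "elt B (t + 1) \<le> elt \<beta> (t + 1) - 1"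
      using elt_le_iff[of B "t + 1" "elt \<beta> (t + 1) - 1"] gt mem[OF that] t' by (auto simp: L)
    moreover have "elt \<beta> (t + 1) \<le> elt B (t + 1)"
      using mem(4)[OF that] t'(2) unfolding ple_def by blast
    ultimately show False using \<open>elt \<beta> (t + 1) \<noteq> 0\<close> by simp
  qed
  have many: "t \<le> card (B \<inter> {..elt \<gamma> t})" if "B \<in> M" for B
    using elt_le_iff[of B t "elt \<gamma> t"] mem[OF that] t' by (auto simp: ple_def)
  have splitU: "card (B \<inter> U) = k - card (B \<inter> {..elt \<gamma> t})" if "B \<in> M" for B
  proof -
    have "B \<inter> U = B - B \<inter> {..elt \<gamma> t}" by (auto simp: U_def)
    then show ?thesis using mem[OF that] by (simp add: card_Diff_subset)
  qed
  have \<beta>L: "\<beta> \<inter> L = elt \<beta> ` {1..t}"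
    using Int_lessThan_elt(1)[of \<beta> t] mem[OF \<beta>] t by (simp add: L_def)
  have "inj_on (elt \<beta>) {1..t}"
    by (rule inj_on_subset[OF elt_image(2)[of \<beta> k]]) (use mem[OF \<beta>] t in auto)
  then have card_\<beta>L: "card (\<beta> \<inter> L) = t" by (simp add: \<beta>L card_image)
  have card_\<alpha>L: "card (\<alpha> \<inter> L) = t"
  proof (rule antisym[OF lower[OF \<alpha>(1)]])
    \<comment> \<open>Because \<open>\<alpha>\<close> avoids the interval, its elements up to \<open>\<gamma>(t)\<close> lie below \<open>\<beta>(t + 1)\<close>.\<close>
    have "\<alpha> \<inter> {..elt \<gamma> t} \<subseteq> \<alpha> \<inter> L" using \<alpha>(2) by (force simp: L_def)
    then have "card (\<alpha> \<inter> {..elt \<gamma> t}) \<le> card (\<alpha> \<inter> L)" using finL by (intro card_mono) auto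
    then show "t \<le> card (\<alpha> \<inter> L)" using many[OF \<alpha>(1)] by simp
  qed
  define \<alpha>' where "\<alpha>' = (\<beta> \<inter> L) \<union> (\<alpha> - L)"
  have \<alpha>': "\<alpha>' \<in> M" unfolding \<alpha>'_def
    by (rule exchange_spanning_part[OF exch mem(3) lower \<beta> card_\<beta>L \<alpha>(1) card_\<alpha>L])
  \<comment> \<open>An element of \<open>\<alpha> - L\<close> is at least \<open>\<beta>(t + 1)\<close> and avoids the interval, hence exceeds \<open>\<gamma>(t)\<close>.\<close>
  have sub: "\<alpha>' \<inter> {..elt \<gamma> t} \<subseteq> \<beta> \<inter> L" using \<alpha>(2) by (force simp: \<alpha>'_def L_def)
  then have card_le: "card (\<alpha>' \<inter> {..elt \<gamma> t}) \<le> t"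
    using card_mono[OF _ sub] finL card_\<beta>L by simp
  have \<alpha>'_low: "\<alpha>' \<inter> {..elt \<gamma> t} = \<beta> \<inter> L"
    using card_le many[OF \<alpha>'] card_\<beta>L finL by (intro card_subset_eq[OF _ sub]) auto
  have \<gamma>U: "\<gamma> \<inter> U = elt \<gamma> ` {t+1..k}"
  proof -
    have mono: "elt \<gamma> i < elt \<gamma> j" if "1 \<le> i" "i < j" "j \<le> k" for i j
      using elt_less[OF mem(3)[OF \<gamma>] that(1,2)] that(3) mem(2)[OF \<gamma>] by simp
    have split_t: "elt \<gamma> t < elt \<gamma> (t + 1)" by (rule mono) (use t' in auto)
    have "x \<ge> elt \<gamma> (t + 1)" if x: "x \<in> \<gamma>" "x > elt \<gamma> t" for x
    proof -
      have "x \<in> elt \<gamma> ` {1..k}" unfolding elt_image(1)[OF mem(3,2)[OF \<gamma>]] by (rule x(1))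
      then obtain i where i: "x = elt \<gamma> i" "i \<in> {1..k}" by blast
      have "t < i"
      proof (rule ccontr)
        assume "\<not> t < i"
        then have "i = t \<or> i < t" by auto
        then show False using mono[of i t] i x(2) t'(1) by auto
      qed
      then have "t + 1 = i \<or> t + 1 < i" by auto
      then show ?thesis using mono[of "t + 1" i] i by auto
    qed
    then have "\<gamma> \<inter> U = \<gamma> \<inter> {elt \<gamma> (t + 1)..}" using split_t by (auto simp: U_def)
    then show ?thesis using Int_lessThan_elt(2)[of \<gamma> t] mem[OF \<gamma>] t by simp
  qed
  have "inj_on (elt \<gamma>) {t+1..k}"
    by (rule inj_on_subset[OF elt_image(2)[of \<gamma> k]]) (use mem[OF \<gamma>] t in auto)
  then have "card (\<gamma> \<inter> U) = k - t" by (simp add: \<gamma>U card_image)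
  moreover have "card (\<alpha>' \<inter> U) = k - t" using splitU[OF \<alpha>'] \<alpha>'_low card_\<beta>L by simp
  moreover have "card (B \<inter> U) \<le> k - t" if "B \<in> M" for B
    using splitU[OF that] many[OF that] by simp
  ultimately have "(\<gamma> \<inter> U) \<union> (\<alpha>' - U) \<in> M"
    by (intro exchange_spanning_part[OF exch mem(3) _ \<gamma> _ \<alpha>'])
  moreover have "\<alpha>' - U = \<alpha>' \<inter> {..elt \<gamma> t}" by (auto simp: U_def)
  then have "\<alpha>' - U = elt \<beta> ` {1..t}" using \<alpha>'_low \<beta>L by simp
  ultimately show ?thesis by (simp add: delta_def \<gamma>U Un_commute)
qed

lemma delta_in_ksubsets:
  assumes "\<beta> \<in> ksubsets k n" "\<gamma> \<in> ksubsets k n" "ple k \<beta> \<gamma>" "t \<le> k"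
  shows "delta k \<beta> \<gamma> t \<in> ksubsets k n"
proof -
  note b = ksubsetsD[OF assms(1)] and c = ksubsetsD[OF assms(2)]
  have "elt \<beta> i < elt \<gamma> j" if "i \<in> {1..t}" "j \<in> {t+1..k}" for i j
  proof -
    have "elt \<beta> i < elt \<beta> j" using elt_less[of \<beta> i j] that b by auto
    also have "\<dots> \<le> elt \<gamma> j" using assms(3) that by (auto simp: ple_def)
    finally show ?thesis .
  qed
  then have "elt \<beta> ` {1..t} \<inter> elt \<gamma> ` {t+1..k} = {}" by fastforce
  moreover have "inj_on (elt \<beta>) {1..t}" "inj_on (elt \<gamma>) {t+1..k}"
    using elt_image(2)[OF b(3,2)] elt_image(2)[OF c(3,2)] assms(4)
    by (auto elim!: inj_on_subset)
  ultimately have "card (delta k \<beta> \<gamma> t) = k"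
    using assms(4) by (simp add: delta_def card_Un_disjoint card_image)
  moreover have "elt \<beta> ` {1..t} \<subseteq> elt \<beta> ` {1..k}" "elt \<gamma> ` {t+1..k} \<subseteq> elt \<gamma> ` {1..k}"
    using assms(4) by (auto intro!: image_mono)
  then have "delta k \<beta> \<gamma> t \<subseteq> \<beta> \<union> \<gamma>"
    using elt_image(1)[OF b(3,2)] elt_image(1)[OF c(3,2)] by (auto simp: delta_def)
  ultimately show ?thesis using b(1) c(1) by (auto simp: ksubsets_def)
qed

lemma delta_mem_iff_not_subset:
  assumes k: "1 \<le> k" and \<beta>: "\<beta> \<in> ksubsets k n" and \<gamma>: "\<gamma> \<in> ksubsets k n"
    and exch: "symmetric_exchange M" and M: "M \<subseteq> pinterval k n \<beta> \<gamma>" "M \<noteq> {}"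
  shows "(\<forall>t\<in>{0..k}. delta k \<beta> \<gamma> t \<in> M) \<longleftrightarrow>
    (\<forall>N\<in>Sigma0 k n \<beta> \<gamma> \<union> Sigma1 k n \<beta> \<gamma> \<union> Sigma2 k n \<beta> \<gamma>. \<not> M \<subseteq> N)"
proof -
  note b = ksubsetsD[OF \<beta>] and c = ksubsetsD[OF \<gamma>]
  have delta_k: "delta k \<beta> \<gamma> k = \<beta>" using elt_image(1)[of \<beta> k] b by (simp add: delta_def)
  have delta_0: "delta k \<beta> \<gamma> 0 = \<gamma>" using elt_image(1)[of \<gamma> k] c by (simp add: delta_def)
  show ?thesis
  proof
    assume d: "\<forall>t\<in>{0..k}. delta k \<beta> \<gamma> t \<in> M"
    have "\<beta> \<in> M" "\<gamma> \<in> M" using d delta_k delta_0 by (metis atLeastAtMost_iff le_refl zero_le)+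
    show "\<forall>N\<in>Sigma0 k n \<beta> \<gamma> \<union> Sigma1 k n \<beta> \<gamma> \<union> Sigma2 k n \<beta> \<gamma>. \<not> M \<subseteq> N"
    proof (intro ballI notI)
      fix N assume N: "N \<in> Sigma0 k n \<beta> \<gamma> \<union> Sigma1 k n \<beta> \<gamma> \<union> Sigma2 k n \<beta> \<gamma>" and sub: "M \<subseteq> N"
      then consider (0) t where "N = Pset k n \<beta> \<gamma> t" "1 \<le> t" "t \<le> k - 1"
        | (1) \<beta>' where "N = pinterval k n \<beta>' \<gamma>" "pcovers k n \<beta> \<beta>'"
        | (2) \<gamma>' where "N = pinterval k n \<beta> \<gamma>'" "pcovers k n \<gamma>' \<gamma>"
        by (auto simp: Sigma0_def Sigma1_def Sigma2_def)
      then show False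
      proof cases
        case 0
        then have "delta k \<beta> \<gamma> t \<in> N" using d sub by auto
        then show False using 0 delta_not_in_Pset[OF \<beta> \<gamma>] by simp
      next
        case 1
        then have "ple k \<beta>' \<beta>" using \<open>\<beta> \<in> M\<close> sub by (auto simp: pinterval_def)
        then show False using 1(2) ple_antisym[of \<beta> \<beta>' k] ksubsetsD by (auto simp: pcovers_def)
      next
        case 2
        then have "ple k \<gamma> \<gamma>'" using \<open>\<gamma> \<in> M\<close> sub by (auto simp: pinterval_def)
        then show False using 2(2) ple_antisym[of \<gamma> \<gamma>' k] ksubsetsD by (auto simp: pcovers_def)
      qed
    qed
  next
    assume ns: "\<forall>N\<in>Sigma0 k n \<beta> \<gamma> \<union> Sigma1 k n \<beta> \<gamma> \<union> Sigma2 k n \<beta> \<gamma>. \<not> M \<subseteq> N"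
    have Mk: "M \<subseteq> ksubsets k n" using M by (auto simp: pinterval_def)
    have bounds: "ple k \<beta> C" "ple k C \<gamma>" if "C \<in> M" for C using that M by (auto simp: pinterval_def)
    have "\<beta> \<in> M"
    proof (rule ccontr)
      assume "\<beta> \<notin> M"
      obtain \<mu> where \<mu>: "\<mu> \<in> M" "\<And>C. C \<in> M \<Longrightarrow> ple k \<mu> C"
        using ple_least_exists[OF exch Mk M(2)] by metis
      obtain \<beta>' where \<beta>': "pcovers k n \<beta> \<beta>'" "ple k \<beta>' \<mu>"
        using upper_cover_exists[OF \<beta> _ bounds(1)[OF \<mu>(1)]] \<mu>(1) Mk \<open>\<beta> \<notin> M\<close> by blast
      have "M \<subseteq> pinterval k n \<beta>' \<gamma>"
        using Mk bounds(2) ple_trans[OF \<beta>'(2) \<mu>(2)] by (auto simp: pinterval_def)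
      moreover have "ple k \<beta>' \<gamma>" using \<beta>'(2) bounds(2)[OF \<mu>(1)] by (rule ple_trans)
      ultimately show False using ns \<beta>'(1) by (auto simp: Sigma1_def)
    qed
    have "\<gamma> \<in> M"
    proof (rule ccontr)
      assume "\<gamma> \<notin> M"
      obtain \<mu> where \<mu>: "\<mu> \<in> M" "\<And>C. C \<in> M \<Longrightarrow> ple k C \<mu>"
        using ple_greatest_exists[OF exch Mk M(2)] by metis
      obtain \<gamma>' where \<gamma>': "pcovers k n \<gamma>' \<gamma>" "ple k \<mu> \<gamma>'"
        using lower_cover_exists[OF \<gamma> _ bounds(2)[OF \<mu>(1)]] \<mu>(1) Mk \<open>\<gamma> \<notin> M\<close> by blast
      have "M \<subseteq> pinterval k n \<beta> \<gamma>'"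
        using Mk bounds(1) ple_trans[OF \<mu>(2) \<gamma>'(2)] by (auto simp: pinterval_def)
      moreover have "ple k \<beta> \<gamma>'" using bounds(1)[OF \<mu>(1)] \<gamma>'(2) by (rule ple_trans)
      ultimately show False using ns \<gamma>'(1) by (auto simp: Sigma2_def)
    qed
    show "\<forall>t\<in>{0..k}. delta k \<beta> \<gamma> t \<in> M"
    proof
      fix t assume "t \<in> {0..k}"
      then consider "t = 0" | "t = k" | "1 \<le> t" "t \<le> k - 1" by fastforce
      then show "delta k \<beta> \<gamma> t \<in> M"
      proof cases
        case 3
        have "\<not> M \<subseteq> Pset k n \<beta> \<gamma> t"
        proof
          assume sub: "M \<subseteq> Pset k n \<beta> \<gamma> t"
          then have "Pset k n \<beta> \<gamma> t \<in> Sigma0 k n \<beta> \<gamma>" using M(2) 3 by (auto simp: Sigma0_def)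
          then show False using ns sub by blast
        qed
        then obtain \<alpha> where "\<alpha> \<in> M" "\<alpha> \<inter> {elt \<beta> (t + 1)..elt \<gamma> t} = {}"
          using M(1) unfolding Pset_def by blast
        then show ?thesis
          by (rule delta_mem_of_avoiding[OF exch M(1) \<open>\<beta> \<in> M\<close> \<open>\<gamma> \<in> M\<close> 3])
      qed (use delta_k delta_0 \<open>\<beta> \<in> M\<close> \<open>\<gamma> \<in> M\<close> in auto)
    qed
  qed
qed

lemma positroid_Sigma:
  assumes "1 \<le> k" "k \<le> n" and \<beta>: "\<beta> \<in> ksubsets k n" and \<gamma>: "\<gamma> \<in> ksubsets k n"
    and "N \<in> Sigma0 k n \<beta> \<gamma> \<union> Sigma1 k n \<beta> \<gamma> \<union> Sigma2 k n \<beta> \<gamma>"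
  shows "positroid k n N"
proof -
  note b = ksubsetsD[OF \<beta>] and c = ksubsetsD[OF \<gamma>]
  from assms(5) consider (0) t where "N = Pset k n \<beta> \<gamma> t" "N \<noteq> {}" "1 \<le> t" "t \<le> k - 1"
    | (1) \<beta>' where "N = pinterval k n \<beta>' \<gamma>" "pcovers k n \<beta> \<beta>'" "ple k \<beta>' \<gamma>"
    | (2) \<gamma>' where "N = pinterval k n \<beta> \<gamma>'" "pcovers k n \<gamma>' \<gamma>" "ple k \<beta> \<gamma>'"
    by (auto simp: Sigma0_def Sigma1_def Sigma2_def)
  then show ?thesis
  proof cases
    case 0
    show ?thesis
    proof (rule positroid_interval_meet[OF \<beta> \<gamma> _ _ assms(2) _ 0(2)])
      show "elt \<beta> (t + 1) \<in> \<beta>" "elt \<gamma> t \<in> \<gamma>" using elt_in b c 0 by auto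
    qed (simp add: 0 Pset_def)
  next
    case 1
    then show ?thesis using positroid_pinterval \<gamma> assms(1,2) by (auto simp: pcovers_def)
  next
    case 2
    then show ?thesis using positroid_pinterval \<beta> assms(1,2) by (auto simp: pcovers_def)
  qed
qed

section \<open>An exchange relation between minors\<close>

lemma bij_betw_elt:
  assumes "finite A" "card A = k"
  shows "bij_betw (\<lambda>i. elt A (i + 1)) {0..<k} A"
proof -
  have "bij_betw (elt A) {1..k} A" using elt_image[OF assms] by (simp add: bij_betw_def)
  moreover have "bij_betw (\<lambda>i. i + 1) {0..<k} {1..k}"
    by (rule bij_betwI[where g="\<lambda>i. i - 1"]) auto
  ultimately show ?thesis using bij_betw_trans[of "\<lambda>i. i + 1" "{0..<k}" "{1..k}" "elt A" A]
    by (simp only: comp_def)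
qed

text \<open>Listing the columns of a maximal minor in another order changes it only by a sign.\<close>

lemma det_permute_columns_sorted:
  fixes g :: "nat \<Rightarrow> nat \<Rightarrow> 'a::comm_ring_1"
  assumes "inj_on s {0..<k}"
  obtains e :: 'a where "e = 1 \<or> e = -1"
    "det (mat k k (\<lambda>(i, j). g i (s j))) =
       e * det (mat k k (\<lambda>(i, j). g i (elt (s ` {0..<k}) (j + 1))))"
proof -
  let ?A = "s ` {0..<k}"
  have A: "finite ?A" "card ?A = k" using assms by (auto simp: card_image)
  note elt_bij = bij_betw_elt[OF A]
  define q where "q = (\<lambda>j. if j \<in> {0..<k} then inv_into {0..<k} (\<lambda>i. elt ?A (i + 1)) (s j) else j)"
  have sq: "s j = elt ?A (q j + 1)" "q j < k" if "j < k" for j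
  proof -
    have "s j \<in> (\<lambda>i. elt ?A (i + 1)) ` {0..<k}" using elt_bij that by (auto simp: bij_betw_def)
    from f_inv_into_f[OF this] inv_into_into[OF this] that
    show "s j = elt ?A (q j + 1)" "q j < k" by (auto simp: q_def)
  qed
  have q: "q permutes {0..<k}"
  proof (rule bij_imp_permutes)
    have "inj_on q {0..<k}"
    proof (rule inj_onI)
      fix x y assume xy: "x \<in> {0..<k}" "y \<in> {0..<k}" "q x = q y"
      then have "s x = s y" using sq(1)[of x] sq(1)[of y] by simp
      then show "x = y" using assms xy by (simp add: inj_on_def)
    qed
    moreover have "q ` {0..<k} \<subseteq> {0..<k}" using sq by auto
    ultimately show "bij_betw q {0..<k} {0..<k}"
      by (simp add: bij_betw_def endo_inj_surj)
  qed (auto simp: q_def)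
  let ?N = "mat k k (\<lambda>(i, j). g i (elt ?A (j + 1)))"
  have "det (mat k k (\<lambda>(i, j). g i (s j))) = det (transpose_mat (mat k k (\<lambda>(i, j). g i (s j))))"
    by (rule det_transpose[symmetric, where n = k]) simp
  also have "transpose_mat (mat k k (\<lambda>(i, j). g i (s j))) =
      mat k k (\<lambda>(i, j). transpose_mat ?N $$ (q i, j))"
    using sq by (intro eq_matI) auto
  also have "det \<dots> = signof q * det (transpose_mat ?N)"
    by (rule det_permute_rows[OF _ q]) simp
  also have "det (transpose_mat ?N) = det ?N" by (rule det_transpose[where n = k]) simp
  finally show ?thesis by (intro that[of "signof q"]) (auto simp: sign_def)
qed

text \<open>Cramer's rule writes \<open>D b\<close> times column \<open>c j\<close> as a combination of the columns \<open>b l\<close> whose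
  coefficients are the determinants with column \<open>l\<close> of \<open>b\<close> replaced by \<open>c j\<close>; expanding \<open>D c\<close> along
  column \<open>j\<close> gives the relation.  It holds over any commutative ring, without cancellation.\<close>

lemma det_column_exchange:
  fixes g :: "nat \<Rightarrow> nat \<Rightarrow> 'a::comm_ring_1" and b c :: "nat \<Rightarrow> nat" and k :: nat
  defines "D \<equiv> \<lambda>s. det (mat k k (\<lambda>(i, j). g i (s j)))"
  assumes j: "j < k"
  shows "D b * D c = (\<Sum>l<k. D (b(l := c j)) * D (c(j := b l)))"
proof -
  let ?M = "\<lambda>s. mat k k (\<lambda>(i, j). g i (s j))"
  have expand: "D (s(l := x)) = (\<Sum>i<k. g i x * cofactor (?M s) i l)" if "l < k" for s l x
  proof -
    have "D (s(l := x)) = (\<Sum>i<k. ?M (s(l := x)) $$ (i, l) * cofactor (?M (s(l := x))) i l)"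
      unfolding D_def by (rule laplace_expansion_column[OF _ that]) simp
    also have "\<dots> = (\<Sum>i<k. g i x * cofactor (?M s) i l)"
    proof (intro sum.cong refl)
      fix i assume i: "i \<in> {..<k}"
      have "mat_delete (?M (s(l := x))) i l = mat_delete (?M s) i l"
        using i that by (intro eq_matI) (auto simp: mat_delete_def)
      then have "cofactor (?M (s(l := x))) i l = cofactor (?M s) i l" by (simp add: cofactor_def)
      then show "?M (s(l := x)) $$ (i, l) * cofactor (?M (s(l := x))) i l = g i x * cofactor (?M s) i l"
        using i that by simp
    qed
    finally show ?thesis .
  qed
  have adj: "(\<Sum>l<k. g i (b l) * cofactor (?M b) i' l) = (if i = i' then D b else 0)"
    if "i < k" "i' < k" for i i'
  proof -
    have "(?M b * adj_mat (?M b)) $$ (i, i') = (\<Sum>l<k. g i (b l) * cofactor (?M b) i' l)"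
      using that by (simp add: adj_mat_def scalar_prod_def lessThan_atLeast0)
    moreover have "(?M b * adj_mat (?M b)) $$ (i, i') = (D b \<cdot>\<^sub>m 1\<^sub>m k) $$ (i, i')"
      unfolding D_def using adj_mat(2)[of "?M b" k] by simp
    ultimately show ?thesis using that by (simp split: if_splits)
  qed
  have cramer: "(\<Sum>l<k. g i (b l) * D (b(l := c j))) = g i (c j) * D b" if i: "i < k" for i
  proof -
    have "(\<Sum>l<k. g i (b l) * D (b(l := c j))) =
        (\<Sum>l<k. \<Sum>i'<k. g i' (c j) * (g i (b l) * cofactor (?M b) i' l))"
      by (simp add: expand sum_distrib_left ac_simps)
    also have "\<dots> = (\<Sum>i'<k. g i' (c j) * (\<Sum>l<k. g i (b l) * cofactor (?M b) i' l))"
      by (subst sum.swap) (simp add: sum_distrib_left)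
    also have "\<dots> = (\<Sum>i'<k. if i = i' then g i' (c j) * D b else 0)"
      using i by (intro sum.cong) (auto simp: adj)
    also have "\<dots> = g i (c j) * D b" using i by simp
    finally show ?thesis .
  qed
  have "(\<Sum>l<k. D (b(l := c j)) * D (c(j := b l))) =
      (\<Sum>l<k. \<Sum>i<k. cofactor (?M c) i j * (g i (b l) * D (b(l := c j))))"
    by (simp add: expand[OF j] sum_distrib_left ac_simps)
  also have "\<dots> = (\<Sum>i<k. cofactor (?M c) i j * (\<Sum>l<k. g i (b l) * D (b(l := c j))))"
    by (subst sum.swap) (simp add: sum_distrib_left)
  also have "\<dots> = (\<Sum>i<k. D b * (g i (c j) * cofactor (?M c) i j))"
    by (intro sum.cong) (auto simp: cramer ac_simps)
  also have "\<dots> = D b * D (c(j := c j))" by (simp only: expand[OF j] sum_distrib_left)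
  finally show ?thesis by simp
qed

text \<open>The quadratic Pluecker relation for the exchange of a single element \<open>y\<close>.  Only the existence
  of the signs \<open>\<sigma>\<close> matters, not their value.\<close>

lemma generic_minor_exchange:
  fixes B C :: "nat set"
  assumes B: "B \<in> ksubsets k n" and C: "C \<in> ksubsets k n" and y: "y \<in> C" "y \<notin> B"
  obtains \<sigma> :: "nat \<Rightarrow> bool" where
    "(generic_minor k B * generic_minor k C :: (nat \<times> nat, 'k::field) mpol) =
      (\<Sum>x\<in>B - C. (if \<sigma> x then 1 else -1) *
         (generic_minor k (insert y (B - {x})) * generic_minor k (insert x (C - {y}))))"
proof -
  let ?g = "\<lambda>i j. mvar (i + 1, j) :: (nat \<times> nat, 'k) mpol"
  define D where "D s = det (mat k k (\<lambda>(i, j). ?g i (s j)))" for s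
  define b where "b j = elt B (j + 1)" for j
  define c where "c j = elt C (j + 1)" for j
  have bij: "bij_betw (\<lambda>j. elt A (j + 1)) {0..<k} A" if "A \<in> ksubsets k n" for A
    by (rule bij_betw_elt[OF ksubsetsD(3,2)[OF that]])
  have b: "bij_betw b {0..<k} B" unfolding b_def by (rule bij[OF B])
  have c: "bij_betw c {0..<k} C" unfolding c_def by (rule bij[OF C])
  have Db: "D b = generic_minor k B" and Dc: "D c = generic_minor k C"
    by (simp_all add: D_def b_def c_def generic_minor_def)
  have D_inj: "\<exists>\<sigma>. D s = (if \<sigma> then 1 else -1) * generic_minor k (s ` {0..<k})"
    if inj: "inj_on s {0..<k}" for s
  proof -
    obtain e :: "(nat \<times> nat, 'k) mpol" where "e = 1 \<or> e = -1" "D s = e * generic_minor k (s ` {0..<k})"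
      by (rule det_permute_columns_sorted[OF inj, where g = ?g]) (auto simp: D_def generic_minor_def)
    then show ?thesis by (metis (full_types))
  qed
  have swap: "inj_on (s(l := x)) {0..<k}" "(s(l := x)) ` {0..<k} = insert x (A - {s l})"
    if "bij_betw s {0..<k} A" "l < k" "x \<notin> A" for s l x and A :: "nat set"
  proof -
    have s: "inj_on s {0..<k}" "s ` {0..<k} = A" using that by (auto simp: bij_betw_def)
    show "inj_on (s(l := x)) {0..<k}"
      by (rule inj_on_fun_updI[OF s(1)]) (simp only: s(2) that(3) not_False_eq_True)
    have "s ` ({0..<k} - {l}) = A - {s l}"
      using inj_on_image_set_diff[OF s(1), of "{0..<k}" "{l}"] s(2) that(2) by simp
    then show "(s(l := x)) ` {0..<k} = insert x (A - {s l})"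
      using that(2) unfolding fun_upd_image by simp
  qed
  obtain j where j: "j < k" "c j = y" using c y(1) by (auto simp: bij_betw_def)
  have summand: "\<exists>\<sigma>. D (b(l := y)) * D (c(j := b l)) =
      (if b l \<in> C then 0 else (if \<sigma> then 1 else -1) *
         (generic_minor k (insert y (B - {b l})) * generic_minor k (insert (b l) (C - {y}))))"
    if l: "l < k" for l
  proof (cases "b l \<in> C")
    case True
    obtain j' where j': "j' < k" "c j' = b l" using True c by (auto simp: bij_betw_def)
    have "b l \<in> B" using b l by (auto simp: bij_betw_def)
    then have "j' \<noteq> j" using j j' y(2) by auto
    \<comment> \<open>The column \<open>b l\<close> of \<open>C\<close> then occurs twice, at positions \<open>j\<close> and \<open>j'\<close>.\<close>
    have "D (c(j := b l)) = 0" unfolding D_def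
    proof (rule det_identical_columns[OF _ \<open>j' \<noteq> j\<close> j'(1) j(1)])
      show "col (mat k k (\<lambda>(i, ja). ?g i ((c(j := b l)) ja))) j' =
          col (mat k k (\<lambda>(i, ja). ?g i ((c(j := b l)) ja))) j"
        using j j' \<open>j' \<noteq> j\<close> by (intro eq_vecI) auto
    qed simp
    then show ?thesis using True by simp
  next
    case False
    obtain \<sigma>1 where "D (b(l := y)) = (if \<sigma>1 then 1 else -1) * generic_minor k (insert y (B - {b l}))"
      using D_inj swap[OF b l y(2)] by metis
    moreover obtain \<sigma>2 where
      "D (c(j := b l)) = (if \<sigma>2 then 1 else -1) * generic_minor k (insert (b l) (C - {y}))"
      using D_inj swap[OF c j(1) False] j(2) by metis
    ultimately show ?thesis using False by (intro exI[of _ "\<sigma>1 = \<sigma>2"]) simp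
  qed
  have "\<exists>\<sigma>. D (b(inv_into {0..<k} b x := y)) * D (c(j := x)) =
      (if x \<in> C then 0 else (if \<sigma> then 1 else -1) *
         (generic_minor k (insert y (B - {x})) * generic_minor k (insert x (C - {y}))))"
    if "x \<in> B" for x
  proof -
    have x: "x \<in> b ` {0..<k}" using that b by (simp add: bij_betw_def)
    then have "inv_into {0..<k} b x < k" using inv_into_into[OF x] by simp
    from summand[OF this] show ?thesis unfolding f_inv_into_f[OF x] .
  qed
  then obtain \<sigma> where \<sigma>: "\<And>x. x \<in> B \<Longrightarrow> D (b(inv_into {0..<k} b x := y)) * D (c(j := x)) =
      (if x \<in> C then 0 else (if \<sigma> x then 1 else -1) *
         (generic_minor k (insert y (B - {x})) * generic_minor k (insert x (C - {y}))))"
    by metis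
  have "generic_minor k B * generic_minor k C = (\<Sum>l\<in>{0..<k}. D (b(l := y)) * D (c(j := b l)))"
    using det_column_exchange[OF j(1), of ?g b c] Db Dc j(2) by (simp add: D_def lessThan_atLeast0)
  also have "\<dots> = (\<Sum>l\<in>{0..<k}. D (b(inv_into {0..<k} b (b l) := y)) * D (c(j := b l)))"
    using b by (intro sum.cong) (auto simp: bij_betw_def inv_into_f_f)
  also have "\<dots> = (\<Sum>x\<in>B. D (b(inv_into {0..<k} b x := y)) * D (c(j := x)))"
    by (rule sum.reindex_bij_betw[OF b])
  also have "\<dots> = (\<Sum>x\<in>B. if x \<in> C then 0 else (if \<sigma> x then 1 else -1) *
         (generic_minor k (insert y (B - {x})) * generic_minor k (insert x (C - {y}))))"
    by (intro sum.cong refl \<sigma>)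
  also have "\<dots> = (\<Sum>x\<in>B - C. (if \<sigma> x then 1 else -1) *
         (generic_minor k (insert y (B - {x})) * generic_minor k (insert x (C - {y}))))"
    using ksubsetsD(3)[OF B] by (intro sum.mono_neutral_cong_right) auto
  finally show ?thesis by (rule that)
qed

section \<open>Polynomial rings and the Pluecker ideal\<close>

text \<open>The value of the monomial with exponent \<open>m\<close> at the point \<open>f\<close>.\<close>

definition monomial_value :: "('x \<Rightarrow> ('y, 'k::field) mpol) \<Rightarrow> ('x \<Rightarrow>\<^sub>0 nat) \<Rightarrow> ('y, 'k) mpol" where
  "monomial_value f m = (\<Prod>x\<in>Poly_Mapping.keys m. f x ^ Poly_Mapping.lookup m x)"

lemma monomial_value_superset:
  assumes "finite A" "Poly_Mapping.keys m \<subseteq> A"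
  shows "monomial_value f m = (\<Prod>x\<in>A. f x ^ Poly_Mapping.lookup m x)"
  unfolding monomial_value_def using assms
  by (intro prod.mono_neutral_left) (auto simp: in_keys_iff)

lemma monomial_value_0 [simp]: "monomial_value f 0 = 1"
  by (simp add: monomial_value_def)

lemma monomial_value_add: "monomial_value f (a + b) = monomial_value f a * monomial_value f b"
proof -
  let ?A = "Poly_Mapping.keys a \<union> Poly_Mapping.keys b"
  have "monomial_value f (a + b) = (\<Prod>x\<in>?A. f x ^ Poly_Mapping.lookup (a + b) x)"
    by (rule monomial_value_superset) (auto dest: subsetD[OF keys_add])
  also have "\<dots> = (\<Prod>x\<in>?A. f x ^ Poly_Mapping.lookup a x) * (\<Prod>x\<in>?A. f x ^ Poly_Mapping.lookup b x)"
    by (simp add: lookup_add power_add prod.distrib)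
  also have "\<dots> = monomial_value f a * monomial_value f b"
    by (simp add: monomial_value_superset[of ?A])
  finally show ?thesis .
qed

lemma msubst_superset:
  assumes "finite A" "Poly_Mapping.keys p \<subseteq> A"
  shows "msubst f p = (\<Sum>m\<in>A. Poly_Mapping.single 0 (Poly_Mapping.lookup p m) * monomial_value f m)"
  unfolding msubst_def monomial_value_def[symmetric] using assms
  by (intro sum.mono_neutral_left) (auto simp: in_keys_iff)

lemma msubst_0 [simp]: "msubst f 0 = 0"
  by (simp add: msubst_def)

lemma msubst_add: "msubst f (p + q) = msubst f p + msubst f q"
proof -
  let ?A = "Poly_Mapping.keys p \<union> Poly_Mapping.keys q"
  have "Poly_Mapping.keys (p + q) \<subseteq> ?A" by (rule keys_add)
  then have "msubst f (p + q) =
      (\<Sum>m\<in>?A. Poly_Mapping.single 0 (Poly_Mapping.lookup (p + q) m) * monomial_value f m)"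
    by (intro msubst_superset) auto
  also have "\<dots> = msubst f p + msubst f q"
    by (simp add: msubst_superset[of ?A] lookup_add single_add distrib_right sum.distrib)
  finally show ?thesis .
qed

lemma msubst_sum: "msubst f (sum g A) = (\<Sum>x\<in>A. msubst f (g x))"
  by (induction A rule: infinite_finite_induct) (simp_all add: msubst_add)

lemma msubst_single: "msubst f (Poly_Mapping.single m c) = Poly_Mapping.single 0 c * monomial_value f m"
  using msubst_superset[of "{m}" "Poly_Mapping.single m c" f] by simp

lemma mpol_eq_sum_monomials:
  fixes p :: "('x, 'k::field) mpol"
  shows "p = (\<Sum>m\<in>Poly_Mapping.keys p. Poly_Mapping.single m (Poly_Mapping.lookup p m))"
  by (rule poly_mapping_eqI) (simp add: lookup_sum lookup_single when_def in_keys_iff)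

lemma msubst_mult:
  fixes f :: "'x \<Rightarrow> ('y, 'k::field) mpol"
  shows "msubst f (p * q) = msubst f p * msubst f q"
proof -
  let ?s = "\<lambda>p m. Poly_Mapping.single m (Poly_Mapping.lookup p m) :: ('x, 'k) mpol"
  have single: "msubst f (?s p m * ?s q m') = msubst f (?s p m) * msubst f (?s q m')" for m m'
  proof -
    have "Poly_Mapping.single (0 :: 'y \<Rightarrow>\<^sub>0 nat) (a * b) = Poly_Mapping.single 0 a * Poly_Mapping.single 0 b"
      for a b :: 'k by (simp add: mult_single)
    then show ?thesis by (simp add: mult_single msubst_single monomial_value_add ac_simps)
  qed
  have "msubst f ((\<Sum>m\<in>Poly_Mapping.keys p. ?s p m) * (\<Sum>m\<in>Poly_Mapping.keys q. ?s q m)) =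
      msubst f (\<Sum>m\<in>Poly_Mapping.keys p. ?s p m) * msubst f (\<Sum>m\<in>Poly_Mapping.keys q. ?s q m)"
    by (simp only: sum_product msubst_sum single)
  then show ?thesis by (simp only: mpol_eq_sum_monomials[symmetric])
qed

lemma msubst_1 [simp]: "msubst f 1 = 1"
  using msubst_single[of f 0 1] by simp

lemma msubst_uminus: "msubst f (- p) = - msubst f p"
  using msubst_add[of f p "- p"] by (simp add: add_eq_0_iff)

lemma msubst_mvar [simp]: "msubst f (mvar x) = f x"
  by (simp add: mvar_def msubst_single monomial_value_def)

text \<open>The ring operations introduce no new variables; hence the
  polynomials in the variables \<open>V\<close> form a ring.\<close>

lemma mvars_0: "mvars 0 = {}" and mvars_1: "mvars 1 = {}" and mvars_mvar: "mvars (mvar x) = {x}"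
  and mvars_uminus: "mvars (- p) = mvars p"
  by (auto simp: mvars_def mvar_def in_keys_iff)

lemma mvars_add: "mvars (p + q) \<subseteq> mvars p \<union> mvars q"
  using keys_add[of p q] by (fastforce simp: mvars_def)

lemma mvars_mult: "mvars (p * q) \<subseteq> mvars p \<union> mvars q"
proof
  fix x assume "x \<in> mvars (p * q)"
  then obtain m where "m \<in> Poly_Mapping.keys (p * q)" "x \<in> Poly_Mapping.keys m"
    by (auto simp: mvars_def)
  then obtain a b where "a \<in> Poly_Mapping.keys p" "b \<in> Poly_Mapping.keys q" "x \<in> Poly_Mapping.keys (a + b)"
    using keys_mult[of p q] by blast
  then show "x \<in> mvars p \<union> mvars q" using keys_add[of a b] by (auto simp: mvars_def)
qed

lemma poly_ring_simps [simp]: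
  "carrier (poly_ring V) = {p. mvars p \<subseteq> V}"
  "monoid.mult (poly_ring V) = (*)" "one (poly_ring V) = 1"
  "zero (poly_ring V) = 0" "add (poly_ring V) = (+)"
  by (simp_all add: poly_ring_def)

lemma cring_poly_ring: "cring (poly_ring V :: ('x, 'k::field) mpol graded_ring)"
proof (rule cringI)
  show "abelian_group (poly_ring V :: ('x, 'k) mpol graded_ring)"
  proof (rule abelian_groupI)
    fix x :: "('x, 'k) mpol" assume "x \<in> carrier (poly_ring V)"
    then show "\<exists>y\<in>carrier (poly_ring V). y \<oplus>\<^bsub>poly_ring V\<^esub> x = \<zero>\<^bsub>poly_ring V\<^esub>"
      by (intro bexI[of _ "- x"]) (simp_all add: mvars_uminus)
  next
    fix x y :: "('x, 'k) mpol" assume "x \<in> carrier (poly_ring V)" "y \<in> carrier (poly_ring V)"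
    then show "x \<oplus>\<^bsub>poly_ring V\<^esub> y \<in> carrier (poly_ring V)" using mvars_add[of x y] by auto
  qed (simp_all add: mvars_0 ac_simps)
  show "comm_monoid (poly_ring V :: ('x, 'k) mpol graded_ring)"
  proof (rule comm_monoidI)
    fix x y :: "('x, 'k) mpol" assume "x \<in> carrier (poly_ring V)" "y \<in> carrier (poly_ring V)"
    then show "x \<otimes>\<^bsub>poly_ring V\<^esub> y \<in> carrier (poly_ring V)" using mvars_mult[of x y] by auto
  qed (simp_all add: mvars_1 ac_simps)
qed (simp add: distrib_right)

lemma grade_poly_ring_closed: "grade (poly_ring V) d \<subseteq> carrier (poly_ring V)"
  by (auto simp: poly_ring_def)

lemma ideal_plucker: "ideal (plucker_ideal K k n) (poly_ring (ksubsets k n))"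
proof -
  let ?P = "poly_ring (ksubsets k n) :: (nat set, 'a) mpol graded_ring"
  interpret P: cring ?P by (rule cring_poly_ring)
  have inv: "\<ominus>\<^bsub>?P\<^esub> a = - a" if "a \<in> carrier ?P" for a
    by (rule P.minus_equality) (use that in \<open>simp_all add: mvars_uminus\<close>)
  show ?thesis
  proof (rule idealI[OF P.ring_axioms])
    show "subgroup (plucker_ideal K k n) (add_monoid ?P)"
    proof (rule P.add.subgroupI)
      show "plucker_ideal K k n \<subseteq> carrier ?P" by (auto simp: plucker_ideal_def)
      have "0 \<in> plucker_ideal K k n" by (simp add: plucker_ideal_def mvars_0)
      then show "plucker_ideal K k n \<noteq> {}" by blast
    next
      fix a assume "a \<in> plucker_ideal K k n"
      then have a: "a \<in> carrier ?P" "msubst (generic_minor k) a = 0" by (auto simp: plucker_ideal_def)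
      then show "\<ominus>\<^bsub>?P\<^esub> a \<in> plucker_ideal K k n"
        by (simp add: inv plucker_ideal_def mvars_uminus msubst_uminus)
      fix b assume "b \<in> plucker_ideal K k n"
      then show "a \<oplus>\<^bsub>?P\<^esub> b \<in> plucker_ideal K k n"
        using a mvars_add[of a b] by (auto simp: plucker_ideal_def msubst_add)
    qed
  next
    fix a x assume "a \<in> plucker_ideal K k n" "x \<in> carrier ?P"
    then show "x \<otimes>\<^bsub>?P\<^esub> a \<in> plucker_ideal K k n" "a \<otimes>\<^bsub>?P\<^esub> x \<in> plucker_ideal K k n"
      using mvars_mult[of x a] mvars_mult[of a x] by (auto simp: plucker_ideal_def msubst_mult)
  qed
qed

lemma sum_mem_ideal_poly_ring:
  assumes "ideal I (poly_ring V)" "\<And>x. x \<in> A \<Longrightarrow> g x \<in> (I :: ('x, 'k::field) mpol set)"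
  shows "sum g A \<in> I"
proof -
  have sub: "additive_subgroup I (poly_ring V)" using assms(1) by (rule ideal.axioms)
  show ?thesis using assms(2)
  proof (induction A rule: infinite_finite_induct)
    case (insert x A)
    then show ?case using additive_subgroup.a_closed[OF sub, of "g x" "sum g A"] by simp
  qed (use additive_subgroup.zero_closed[OF sub] in auto)
qed

text \<open>An ideal that contains all variables contains all forms of positive degree.\<close>

lemma grade_subset_of_variables:
  assumes "ideal I (poly_ring V)" "\<And>x. x \<in> V \<Longrightarrow> mvar x \<in> I" "1 \<le> d"
  shows "grade (poly_ring V) d \<subseteq> (I :: ('x, 'k::field) mpol set)"
proof
  interpret I: ideal I "poly_ring V" by fact
  fix f :: "('x, 'k) mpol" assume f: "f \<in> grade (poly_ring V) d"
  have mono: "Poly_Mapping.single m (Poly_Mapping.lookup f m) \<in> I" if m: "m \<in> Poly_Mapping.keys f" for m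
  proof -
    have "mdeg m = d" and mV: "Poly_Mapping.keys m \<subseteq> V"
      using f m by (auto simp: poly_ring_def mvars_def)
    then have "Poly_Mapping.keys m \<noteq> {}" using assms(3) by (auto simp: mdeg_def)
    then obtain x where x: "x \<in> Poly_Mapping.keys m" by blast
    let ?m = "m - Poly_Mapping.single x 1"
    have m_eq: "m = Poly_Mapping.single x 1 + ?m"
      using x by (intro poly_mapping_eqI)
        (auto simp: lookup_add lookup_minus lookup_single when_def in_keys_iff)
    have "Poly_Mapping.keys ?m \<subseteq> Poly_Mapping.keys m"
      by (auto simp: in_keys_iff lookup_minus)
    then have "Poly_Mapping.single ?m (Poly_Mapping.lookup f m) \<in> carrier (poly_ring V)"
      using mV by (auto simp: mvars_def)
    moreover have "mvar x \<in> I" using assms(2) x mV by blast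
    ultimately have "mvar x * Poly_Mapping.single ?m (Poly_Mapping.lookup f m) \<in> I"
      using I.I_r_closed by simp
    moreover have "mvar x * Poly_Mapping.single ?m (Poly_Mapping.lookup f m) =
        Poly_Mapping.single m (Poly_Mapping.lookup f m)"
      by (simp only: mvar_def mult_single mult_1 m_eq[symmetric])
    ultimately show ?thesis by simp
  qed
  then show "f \<in> I"
    by (subst mpol_eq_sum_monomials) (rule sum_mem_ideal_poly_ring[OF assms(1)])
qed

section \<open>Closed subsets of Proj of a graded quotient\<close>

lemma graded_quot_simps [simp]:
  "carrier (graded_quot S J) = carrier (S Quot J)"
  "monoid.mult (graded_quot S J) = monoid.mult (S Quot J)"
  "one (graded_quot S J) = one (S Quot J)"
  "zero (graded_quot S J) = zero (S Quot J)"
  "add (graded_quot S J) = add (S Quot J)"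
  "grade (graded_quot S J) d = (\<lambda>x. J +>\<^bsub>S\<^esub> x) ` grade S d"
  by (simp_all add: graded_quot_def ring.defs graded_ring.defs)

lemma cring_cong:
  fixes R :: "('a, 'b) ring_scheme" and R' :: "('a, 'c) ring_scheme"
  assumes "cring R" "carrier R' = carrier R" "monoid.mult R' = monoid.mult R" "one R' = one R"
    "zero R' = zero R" "add R' = add R"
  shows "cring R'"
proof -
  interpret R: cring R by fact
  show ?thesis
  proof (rule cringI)
    show "abelian_group R'"
    proof (rule abelian_groupI)
      fix x assume "x \<in> carrier R'"
      then show "\<exists>y\<in>carrier R'. y \<oplus>\<^bsub>R'\<^esub> x = \<zero>\<^bsub>R'\<^esub>"
        by (intro bexI[of _ "\<ominus>\<^bsub>R\<^esub> x"]) (simp_all add: assms(2-) R.l_neg)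
    qed (simp_all add: assms(2-) R.a_ac)
    show "comm_monoid R'"
      by (rule comm_monoidI) (simp_all add: assms(2-) R.m_ac)
  qed (simp_all add: assms(2-) R.l_distr)
qed

text \<open>A surjective homomorphism of graded commutative rings for which the grading of the target is
  the image of the grading of the source.  No directness of the grading is needed.\<close>

locale graded_surjection = ring_hom_cring R S h
  for R :: "('a, 'r) graded_ring_scheme" (structure)
    and S :: "('b, 's) graded_ring_scheme" (structure) and h +
  assumes surj: "h ` carrier R = carrier S"
    and grade_image: "grade S d = h ` grade R d"
    and grade_closed: "grade R d \<subseteq> carrier R"
begin

lemma homog_closed: "homog R \<subseteq> carrier R" "homog S \<subseteq> carrier S" "homog S = h ` homog R"
  using grade_closed by (auto simp: homog_def grade_image)

lemma grade_closed': "grade S d \<subseteq> carrier S"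
  using grade_closed[of d] by (auto simp: grade_image)

text \<open>A point of the source that contains the kernel is the preimage of a point of the target, namely
  of its own image.\<close>

lemma proj_point_image:
  assumes p: "p \<in> proj_points R" and ker: "\<And>c. c \<in> carrier R \<Longrightarrow> h c = \<zero>\<^bsub>S\<^esub> \<Longrightarrow> c \<in> p"
  obtains q where "q \<in> proj_points S" "p = {c \<in> carrier R. h c \<in> q}"
proof -
  have prime: "primeideal p R" and hom_p: "homogeneous_ideal R p" and rel: "\<not> irrelevant_ideal R \<subseteq> p"
    using p by (auto simp: proj_points_def)
  interpret p: primeideal p R by (rule prime)
  let ?q = "h ` p"
  have mem: "h c \<in> ?q \<longleftrightarrow> c \<in> p" if c: "c \<in> carrier R" for c
  proof
    assume "h c \<in> ?q"
    then obtain a where a: "a \<in> p" "h c = h a" by auto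
    have "a \<in> carrier R" using a by simp
    then have "h (c \<ominus> a) = \<zero>\<^bsub>S\<^esub>" using a c by (simp add: R.minus_eq S.r_neg)
    then have "c \<ominus> a \<in> p" using ker c \<open>a \<in> carrier R\<close> by simp
    then have "(c \<ominus> a) \<oplus> a \<in> p" using a by simp
    then show "c \<in> p" using c \<open>a \<in> carrier R\<close> by (simp add: R.minus_eq R.a_assoc R.l_neg)
  qed simp
  have ideal_q: "ideal ?q S"
  proof (rule idealI)
    show "ring S" by (rule S.ring_axioms)
    show "subgroup ?q (add_monoid S)"
      by (rule ring.img_is_add_subgroup) (rule p.a_subgroup)
  next
    fix a x assume a: "a \<in> ?q" and x: "x \<in> carrier S"
    obtain a' where a': "a' \<in> p" "a = h a'" using a by blast
    obtain x' where x': "x' \<in> carrier R" "x = h x'" using x surj by blast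
    have "h (x' \<otimes> a') \<in> ?q" using a' x' p.I_l_closed by blast
    then show "x \<otimes>\<^bsub>S\<^esub> a \<in> ?q" using a' x' by simp
    have "h (a' \<otimes> x') \<in> ?q" using a' x' p.I_r_closed by blast
    then show "a \<otimes>\<^bsub>S\<^esub> x \<in> ?q" using a' x' by simp
  qed
  have pq: "p = {c \<in> carrier R. h c \<in> ?q}" using mem by auto
  have prime_q: "primeideal ?q S"
  proof (rule primeidealI[OF ideal_q S.is_cring])
    show "carrier S \<noteq> ?q"
    proof
      assume "carrier S = ?q"
      then have "carrier R \<subseteq> p" using mem by auto
      then show False using p.I_notcarr p.a_subset by auto
    qed
  next
    fix a b assume ab: "a \<in> carrier S" "b \<in> carrier S" "a \<otimes>\<^bsub>S\<^esub> b \<in> ?q"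
    obtain a' where a': "a' \<in> carrier R" "a = h a'" using ab(1) surj by blast
    obtain b' where b': "b' \<in> carrier R" "b = h b'" using ab(2) surj by blast
    have "a' \<otimes> b' \<in> p" using mem[of "a' \<otimes> b'"] ab(3) a' b' by simp
    then show "a \<in> ?q \<or> b \<in> ?q" using p.I_prime a' b' by blast
  qed
  have "homogeneous_ideal S ?q"
  proof -
    let ?I = "Idl\<^bsub>S\<^esub> (?q \<inter> homog S)"
    have sub: "?q \<inter> homog S \<subseteq> carrier S" using homog_closed by blast
    have "?I \<subseteq> ?q" by (rule S.genideal_minimal[OF ideal_q]) simp
    moreover have "?q \<subseteq> ?I"
    proof -
      let ?J = "{r \<in> carrier R. h r \<in> ?I}"
      have "ideal ?J R" by (rule ring.ideal_vimage[OF S.genideal_ideal[OF sub]])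
      moreover have "p \<inter> homog R \<subseteq> ?J"
        using S.genideal_self[OF sub] homog_closed by auto
      ultimately have "Idl (p \<inter> homog R) \<subseteq> ?J" by (rule R.genideal_minimal)
      then show ?thesis using hom_p by (auto simp: homogeneous_ideal_def)
    qed
    ultimately show ?thesis using ideal_q by (auto simp: homogeneous_ideal_def)
  qed
  moreover have "\<not> irrelevant_ideal S \<subseteq> ?q"
  proof
    assume le: "irrelevant_ideal S \<subseteq> ?q"
    have "(\<Union>d\<in>{1..}. grade S d) \<subseteq> irrelevant_ideal S"
      unfolding irrelevant_ideal_def using grade_closed' by (intro S.genideal_self) blast
    then have sub: "h x \<in> ?q" if "x \<in> grade R d" "1 \<le> d" for x d
      using that le unfolding grade_image by blast
    have "(\<Union>d\<in>{1..}. grade R d) \<subseteq> p"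
    proof
      fix x assume "x \<in> (\<Union>d\<in>{1..}. grade R d)"
      then obtain d where d: "x \<in> grade R d" "1 \<le> d" by auto
      then have "x \<in> carrier R" using grade_closed by blast
      then show "x \<in> p" using sub[OF d] mem by blast
    qed
    then have "irrelevant_ideal R \<subseteq> p"
      unfolding irrelevant_ideal_def by (intro R.genideal_minimal p.is_ideal)
    then show False using rel by simp
  qed
  ultimately have "?q \<in> proj_points S" using prime_q by (simp add: proj_points_def)
  then show ?thesis using that pq by blast
qed

end

lemma graded_surjection_quot:
  assumes "cring A" "ideal I A" "\<And>d. grade A d \<subseteq> carrier A"
  shows "graded_surjection A (graded_quot A I) (\<lambda>x. I +>\<^bsub>A\<^esub> x)"
    and "\<And>a. a \<in> carrier A \<Longrightarrow> I +>\<^bsub>A\<^esub> a = \<zero>\<^bsub>graded_quot A I\<^esub> \<longleftrightarrow> a \<in> I"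
proof -
  interpret A: cring A by fact
  interpret I: ideal I A by fact
  have cr: "cring (graded_quot A I)"
    by (rule cring_cong[OF I.quotient_is_cring[OF assms(1)]]) simp_all
  have "(\<lambda>x. I +>\<^bsub>A\<^esub> x) \<in> Ring.ring_hom A (graded_quot A I)"
    using I.rcos_ring_hom unfolding Ring.ring_hom_def graded_quot_simps .
  then have rh: "ring_hom_cring A (graded_quot A I) (\<lambda>x. I +>\<^bsub>A\<^esub> x)"
    by (intro ring_hom_cring.intro ring_hom_cring_axioms.intro A.is_cring cr)
  have "(\<lambda>x. I +>\<^bsub>A\<^esub> x) ` carrier A = carrier (graded_quot A I)"
    unfolding graded_quot_simps FactRing_def A_RCOSETS_def' partial_object.simps by blast
  then show "graded_surjection A (graded_quot A I) (\<lambda>x. I +>\<^bsub>A\<^esub> x)"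
    by (intro graded_surjection.intro graded_surjection_axioms.intro rh assms(3) graded_quot_simps(6))
  show "I +>\<^bsub>A\<^esub> a = \<zero>\<^bsub>graded_quot A I\<^esub> \<longleftrightarrow> a \<in> I" if "a \<in> carrier A" for a
    using that I.a_rcos_const I.a_rcos_self by (auto simp: FactRing_def)
qed

text \<open>For ideals \<open>I \<subseteq> J\<close>, adding \<open>J\<close> to a coset of \<open>I\<close> is the projection from the quotient by \<open>I\<close> to the
  quotient by \<open>J\<close>.\<close>

lemma coset_enlarge:
  assumes "ideal I A" "ideal J A" "I \<subseteq> J" "a \<in> carrier A"
  shows "J <+>\<^bsub>A\<^esub> (I +>\<^bsub>A\<^esub> a) = J +>\<^bsub>A\<^esub> a"
proof -
  interpret I: ideal I A by fact
  interpret J: ideal J A by fact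
  have "\<exists>j\<in>J. m \<oplus>\<^bsub>A\<^esub> (i \<oplus>\<^bsub>A\<^esub> a) = j \<oplus>\<^bsub>A\<^esub> a" if "m \<in> J" "i \<in> I" for m i
  proof (rule bexI)
    show "m \<oplus>\<^bsub>A\<^esub> i \<in> J" using that assms(3) by auto
    show "m \<oplus>\<^bsub>A\<^esub> (i \<oplus>\<^bsub>A\<^esub> a) = (m \<oplus>\<^bsub>A\<^esub> i) \<oplus>\<^bsub>A\<^esub> a"
      using that assms(4) by (simp add: I.a_assoc)
  qed
  then have "J <+>\<^bsub>A\<^esub> (I +>\<^bsub>A\<^esub> a) \<subseteq> J +>\<^bsub>A\<^esub> a"
    unfolding set_add_def' a_r_coset_def' by blast
  moreover have "m \<oplus>\<^bsub>A\<^esub> a \<in> J <+>\<^bsub>A\<^esub> (I +>\<^bsub>A\<^esub> a)" if "m \<in> J" for m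
    using that I.a_rcos_self[OF assms(4)] unfolding set_add_def' by blast
  then have "J +>\<^bsub>A\<^esub> a \<subseteq> J <+>\<^bsub>A\<^esub> (I +>\<^bsub>A\<^esub> a)"
    unfolding a_r_coset_def' by blast
  ultimately show ?thesis by (rule antisym)
qed

lemma graded_surjection_quot_quot:
  assumes "cring A" "ideal I A" "ideal J A" "I \<subseteq> J" "\<And>d. grade A d \<subseteq> carrier A"
  shows "graded_surjection (graded_quot A I) (graded_quot A J) (\<lambda>c. J <+>\<^bsub>A\<^esub> c)"
proof -
  interpret I: graded_surjection A "graded_quot A I" "\<lambda>x. I +>\<^bsub>A\<^esub> x"
    by (rule graded_surjection_quot(1)[OF assms(1,2,5)])
  interpret J: graded_surjection A "graded_quot A J" "\<lambda>x. J +>\<^bsub>A\<^esub> x"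
    by (rule graded_surjection_quot(1)[OF assms(1,3,5)])
  let ?h = "\<lambda>c. J <+>\<^bsub>A\<^esub> c"
  note enl = coset_enlarge[OF assms(2-4)]
  have "?h \<in> Ring.ring_hom (graded_quot A I) (graded_quot A J)"
  proof (rule Ring.ring_hom_memI)
    fix x y assume "x \<in> carrier (graded_quot A I)" "y \<in> carrier (graded_quot A I)"
    then obtain a b where a: "a \<in> carrier A" "x = I +>\<^bsub>A\<^esub> a" and b: "b \<in> carrier A" "y = I +>\<^bsub>A\<^esub> b"
      unfolding I.surj[symmetric] by blast
    show "?h x \<in> carrier (graded_quot A J)" using a enl J.hom_closed by metis
    have "?h (x \<otimes>\<^bsub>graded_quot A I\<^esub> y) = ?h (I +>\<^bsub>A\<^esub> (a \<otimes>\<^bsub>A\<^esub> b))"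
      using I.hom_mult[OF a(1) b(1)] a b by metis
    also have "\<dots> = J +>\<^bsub>A\<^esub> (a \<otimes>\<^bsub>A\<^esub> b)" using a b by (intro enl) simp
    also have "\<dots> = (J +>\<^bsub>A\<^esub> a) \<otimes>\<^bsub>graded_quot A J\<^esub> (J +>\<^bsub>A\<^esub> b)"
      using J.hom_mult[OF a(1) b(1)] by simp
    also have "\<dots> = ?h x \<otimes>\<^bsub>graded_quot A J\<^esub> ?h y" using a b enl by metis
    finally show "?h (x \<otimes>\<^bsub>graded_quot A I\<^esub> y) = ?h x \<otimes>\<^bsub>graded_quot A J\<^esub> ?h y" .
    have "?h (x \<oplus>\<^bsub>graded_quot A I\<^esub> y) = ?h (I +>\<^bsub>A\<^esub> (a \<oplus>\<^bsub>A\<^esub> b))"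
      using I.hom_add[OF a(1) b(1)] a b by metis
    also have "\<dots> = J +>\<^bsub>A\<^esub> (a \<oplus>\<^bsub>A\<^esub> b)" using a b by (intro enl) simp
    also have "\<dots> = (J +>\<^bsub>A\<^esub> a) \<oplus>\<^bsub>graded_quot A J\<^esub> (J +>\<^bsub>A\<^esub> b)"
      using J.hom_add[OF a(1) b(1)] by simp
    also have "\<dots> = ?h x \<oplus>\<^bsub>graded_quot A J\<^esub> ?h y" using a b enl by metis
    finally show "?h (x \<oplus>\<^bsub>graded_quot A I\<^esub> y) = ?h x \<oplus>\<^bsub>graded_quot A J\<^esub> ?h y" .
  next
    show "?h \<one>\<^bsub>graded_quot A I\<^esub> = \<one>\<^bsub>graded_quot A J\<^esub>"
      using I.hom_one J.hom_one enl[of "\<one>\<^bsub>A\<^esub>"] I.R.one_closed by metis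
  qed
  then have rh: "ring_hom_cring (graded_quot A I) (graded_quot A J) ?h"
    by (intro ring_hom_cring.intro ring_hom_cring_axioms.intro I.S.is_cring J.S.is_cring)
  show ?thesis
  proof (intro graded_surjection.intro graded_surjection_axioms.intro rh)
    show "?h ` carrier (graded_quot A I) = carrier (graded_quot A J)"
      unfolding I.surj[symmetric] J.surj[symmetric] image_image
      by (intro image_cong refl enl)
    fix d
    show "grade (graded_quot A J) d = ?h ` grade (graded_quot A I) d"
      unfolding I.grade_image J.grade_image image_image
      using assms(5) by (intro image_cong refl enl[symmetric]) auto
    show "grade (graded_quot A I) d \<subseteq> carrier (graded_quot A I)"
      by (rule I.grade_closed')
  qed
qed

lemma topspace_proj_topology:
  assumes "\<one>\<^bsub>S\<^esub> \<in> homog S"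
  shows "topspace (proj_topology S) = proj_points S"
proof -
  have "\<one>\<^bsub>S\<^esub> \<notin> p" if "p \<in> proj_points S" for p
  proof -
    interpret primeideal p S using that by (simp add: proj_points_def)
    show ?thesis using I_notcarr one_imp_carrier by blast
  qed
  then show ?thesis using assms unfolding proj_topology_def topology_generated_by_topspace by blast
qed

lemma openin_basic_proj:
  assumes "f \<in> homog S"
  shows "openin (proj_topology S) {p \<in> proj_points S. f \<notin> p}"
  unfolding proj_topology_def using assms by (intro topology_generated_by_Basis) blast

section \<open>The coordinate rings of the Pluecker algebra\<close>

lemma graded_surjection_plucker:
  "graded_surjection (poly_ring (ksubsets k n)) (plucker_algebra K k n)
     (\<lambda>f. plucker_ideal K k n +>\<^bsub>poly_ring (ksubsets k n)\<^esub> f)"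
  unfolding plucker_algebra_def
  by (rule graded_surjection_quot(1)[OF cring_poly_ring ideal_plucker grade_poly_ring_closed])

lemma cring_plucker_algebra: "cring (plucker_algebra K k n)"
proof -
  interpret graded_surjection "poly_ring (ksubsets k n)" "plucker_algebra K k n"
    "\<lambda>f. plucker_ideal K k n +>\<^bsub>poly_ring (ksubsets k n)\<^esub> f"
    by (rule graded_surjection_plucker)
  show ?thesis by (rule S.is_cring)
qed

lemma grade_plucker_algebra_closed: "grade (plucker_algebra K k n) d \<subseteq> carrier (plucker_algebra K k n)"
  by (rule graded_surjection.grade_closed'[OF graded_surjection_plucker])

lemma mvar_closed: "\<alpha> \<in> V \<Longrightarrow> mvar \<alpha> \<in> carrier (poly_ring V)"
  by (simp add: mvars_mvar)

lemma plucker_coord_closed: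
  assumes "\<alpha> \<in> ksubsets k n"
  shows "plucker_coord K k n \<alpha> \<in> carrier (plucker_algebra K k n)"
proof -
  interpret graded_surjection "poly_ring (ksubsets k n)" "plucker_algebra K k n"
    "\<lambda>f. plucker_ideal K k n +>\<^bsub>poly_ring (ksubsets k n)\<^esub> f"
    by (rule graded_surjection_plucker)
  show ?thesis unfolding plucker_coord_def by (rule hom_closed[OF mvar_closed[OF assms]])
qed

lemma coords_closed:
  "plucker_coord K k n ` (ksubsets k n - M) \<subseteq> carrier (plucker_algebra K k n)"
  using plucker_coord_closed by blast

lemma ideal_vanishing: "ideal (vanishing_ideal K k n M) (plucker_algebra K k n)"
  unfolding vanishing_ideal_def
  by (rule ring.genideal_ideal[OF cring.axioms(1)[OF cring_plucker_algebra] coords_closed])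

lemma vanishing_ideal_minimal:
  assumes "ideal J (plucker_algebra K k n)"
    and "\<And>\<alpha>. \<alpha> \<in> ksubsets k n - M \<Longrightarrow> plucker_coord K k n \<alpha> \<in> J"
  shows "vanishing_ideal K k n M \<subseteq> J"
  unfolding vanishing_ideal_def using assms(2)
  by (intro ring.genideal_minimal[OF cring.axioms(1)[OF cring_plucker_algebra] assms(1)]) blast

lemma plucker_coord_vanishing:
  assumes "\<alpha> \<in> ksubsets k n - M"
  shows "plucker_coord K k n \<alpha> \<in> vanishing_ideal K k n M"
  unfolding vanishing_ideal_def
  using ring.genideal_self[OF cring.axioms(1)[OF cring_plucker_algebra] coords_closed, of K k n M] assms
  by blast

lemma vanishing_ideal_antimono:
  assumes "M \<subseteq> N"
  shows "vanishing_ideal K k n N \<subseteq> vanishing_ideal K k n M"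
  using assms by (intro vanishing_ideal_minimal ideal_vanishing plucker_coord_vanishing) auto

lemma graded_surjection_coord_ring:
  "graded_surjection (plucker_algebra K k n) (coord_ring K k n M)
     (\<lambda>a. vanishing_ideal K k n M +>\<^bsub>plucker_algebra K k n\<^esub> a)"
  unfolding coord_ring_def
  by (rule graded_surjection_quot(1)[OF cring_plucker_algebra ideal_vanishing grade_plucker_algebra_closed])

lemma coset_vanishing_zero_iff:
  assumes "a \<in> carrier (plucker_algebra K k n)"
  shows "vanishing_ideal K k n M +>\<^bsub>plucker_algebra K k n\<^esub> a = \<zero>\<^bsub>coord_ring K k n M\<^esub> \<longleftrightarrow>
    a \<in> vanishing_ideal K k n M"
  unfolding coord_ring_def
  by (rule graded_surjection_quot(2)[OF cring_plucker_algebra ideal_vanishing grade_plucker_algebra_closed assms])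

text \<open>The residue class in \<open>coord_ring K k n M\<close> of a polynomial in the Pluecker variables, obtained by
  passing first to the Pluecker algebra and then to its quotient.\<close>

definition coord_class ::
  "'k::field itself \<Rightarrow> nat \<Rightarrow> nat \<Rightarrow> nat set set \<Rightarrow> (nat set, 'k) mpol \<Rightarrow> (nat set, 'k) mpol set set" where
  "coord_class K k n M f = vanishing_ideal K k n M +>\<^bsub>plucker_algebra K k n\<^esub>
     (plucker_ideal K k n +>\<^bsub>(poly_ring (ksubsets k n) :: (nat set, 'k) mpol graded_ring)\<^esub> f)"

lemma coord_fun_eq: "coord_fun K k n M \<alpha> = coord_class K k n M (mvar \<alpha>)"
  by (simp add: coord_fun_def plucker_coord_def coord_class_def)

lemma grade_coord_ring: "grade (coord_ring K k n M) d = coord_class K k n M ` grade (poly_ring (ksubsets k n)) d"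
  unfolding graded_surjection.grade_image[OF graded_surjection_coord_ring]
    graded_surjection.grade_image[OF graded_surjection_plucker] image_image coord_class_def ..

lemma coord_fun_homog:
  assumes "\<alpha> \<in> ksubsets k n"
  shows "coord_fun K k n M \<alpha> \<in> homog (coord_ring K k n M)"
proof -
  have "mvar \<alpha> \<in> grade (poly_ring (ksubsets k n)) 1"
    using assms by (simp add: poly_ring_def mvars_mvar) (simp add: mvar_def mdeg_def)
  then show ?thesis unfolding homog_def grade_coord_ring coord_fun_eq by blast
qed

lemma coord_ring_one_homog: "\<one>\<^bsub>coord_ring K k n M\<^esub> \<in> homog (coord_ring K k n M)"
proof -
  interpret P: graded_surjection "poly_ring (ksubsets k n)" "plucker_algebra K k n"
    "\<lambda>f. plucker_ideal K k n +>\<^bsub>poly_ring (ksubsets k n)\<^esub> f"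
    by (rule graded_surjection_plucker)
  interpret A: graded_surjection "plucker_algebra K k n" "coord_ring K k n M"
    "\<lambda>a. vanishing_ideal K k n M +>\<^bsub>plucker_algebra K k n\<^esub> a"
    by (rule graded_surjection_coord_ring)
  have "coord_class K k n M 1 = \<one>\<^bsub>coord_ring K k n M\<^esub>"
    using A.hom_one P.hom_one by (simp add: coord_class_def)
  moreover have "1 \<in> grade (poly_ring (ksubsets k n)) 0"
    by (simp add: poly_ring_def mvars_1 mdeg_def)
  ultimately show ?thesis unfolding homog_def grade_coord_ring by (metis UNIV_I UN_iff imageI)
qed

lemma topspace_coord:
  "topspace (rs_top (X_of K k n M)) = proj_points (coord_ring K k n M)"
  by (simp add: X_of_def Proj_def topspace_proj_topology[OF coord_ring_one_homog])

text \<open>Points of the projective scheme are studied through their preimages in the polynomial ring,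
  which are prime ideals containing the Pluecker ideal.\<close>

lemma prime_pullback:
  fixes K :: "'k::field itself"
  assumes p: "p \<in> proj_points (coord_ring K k n M)"
  defines "J \<equiv> {f \<in> carrier (poly_ring (ksubsets k n)). coord_class K k n M f \<in> p}"
  shows "primeideal J (poly_ring (ksubsets k n))" "plucker_ideal K k n \<subseteq> J"
proof -
  let ?P = "poly_ring (ksubsets k n) :: (nat set, 'k) mpol graded_ring"
  let ?I = "plucker_ideal K k n"
  interpret P: graded_surjection ?P "plucker_algebra K k n" "\<lambda>f. ?I +>\<^bsub>?P\<^esub> f"
    by (rule graded_surjection_plucker)
  interpret A: graded_surjection "plucker_algebra K k n" "coord_ring K k n M"
    "\<lambda>a. vanishing_ideal K k n M +>\<^bsub>plucker_algebra K k n\<^esub> a"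
    by (rule graded_surjection_coord_ring)
  have prime: "primeideal p (coord_ring K k n M)" using p by (simp add: proj_points_def)
  let ?Q = "{a \<in> carrier (plucker_algebra K k n). vanishing_ideal K k n M +>\<^bsub>plucker_algebra K k n\<^esub> a \<in> p}"
  have "primeideal ?Q (plucker_algebra K k n)"
    by (rule A.ring.primeideal_vimage[OF cring_plucker_algebra prime])
  from P.ring.primeideal_vimage[OF cring_poly_ring this]
  have "primeideal {f \<in> carrier ?P. ?I +>\<^bsub>?P\<^esub> f \<in> ?Q} ?P" .
  moreover have "{f \<in> carrier ?P. ?I +>\<^bsub>?P\<^esub> f \<in> ?Q} = J"
    using P.hom_closed unfolding J_def coord_class_def by blast
  ultimately show "primeideal J ?P" by simp
  have zero_p: "\<zero>\<^bsub>coord_ring K k n M\<^esub> \<in> p"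
    using prime by (intro additive_subgroup.zero_closed ideal.axioms(1) primeideal.axioms(1))
  show "?I \<subseteq> J"
  proof
    fix f assume f: "f \<in> ?I"
    have fc: "f \<in> carrier ?P" using f by (simp add: plucker_ideal_def)
    have "?I +>\<^bsub>?P\<^esub> f = \<zero>\<^bsub>plucker_algebra K k n\<^esub>"
      using graded_surjection_quot(2)[OF cring_poly_ring ideal_plucker grade_poly_ring_closed fc] f
      by (simp only: plucker_algebra_def)
    then have "coord_class K k n M f = \<zero>\<^bsub>coord_ring K k n M\<^esub>"
      unfolding coord_class_def using A.ring.hom_zero by metis
    then show "f \<in> J" using zero_p fc by (simp only: J_def mem_Collect_eq)
  qed
qed

text \<open>The set \<open>M\<^sub>p\<close> of the \<open>k\<close>-subsets whose Pluecker coordinate does not vanish at the point \<open>p\<close>.\<close>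

definition nonvanishing ::
  "'k::field itself \<Rightarrow> nat \<Rightarrow> nat \<Rightarrow> nat set set \<Rightarrow> (nat set, 'k) mpol set set set \<Rightarrow> nat set set" where
  "nonvanishing K k n M p = {\<alpha> \<in> ksubsets k n. coord_fun K k n M \<alpha> \<notin> p}"

lemma exchange_ksubsets:
  assumes "B \<in> ksubsets k n" "C \<in> ksubsets k n" "x \<in> B" "y \<in> C" "y \<notin> B"
  shows "insert y (B - {x}) \<in> ksubsets k n"
proof -
  have "0 < k" using ksubsetsD[OF assms(1)] assms(3) by (metis card_gt_0_iff empty_iff)
  then have "card (insert y (B - {x})) = k" using ksubsetsD[OF assms(1)] assms by simp
  then show ?thesis using ksubsetsD(1)[OF assms(1)] ksubsetsD(1)[OF assms(2)] assms(4)
    by (auto simp: ksubsets_def)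
qed

lemma symmetric_exchange_nonvanishing:
  fixes K :: "'k::field itself"
  assumes p: "p \<in> proj_points (coord_ring K k n M)"
  shows "symmetric_exchange (nonvanishing K k n M p)"
  unfolding symmetric_exchange_def
proof (intro ballI)
  let ?P = "poly_ring (ksubsets k n) :: (nat set, 'k) mpol graded_ring"
  define J where "J = {f \<in> carrier ?P. coord_class K k n M f \<in> p}"
  have prime: "primeideal J ?P" and IJ: "plucker_ideal K k n \<subseteq> J"
    using prime_pullback[OF p] by (simp_all only: J_def)
  interpret J: primeideal J ?P by (rule prime)
  have mem: "\<alpha> \<in> nonvanishing K k n M p \<longleftrightarrow> mvar \<alpha> \<notin> J" if "\<alpha> \<in> ksubsets k n" for \<alpha>
    using that by (simp add: nonvanishing_def J_def coord_fun_eq mvars_mvar)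
  fix B C y assume BC: "B \<in> nonvanishing K k n M p" "C \<in> nonvanishing K k n M p" and y: "y \<in> C - B"
  then have B: "B \<in> ksubsets k n" and C: "C \<in> ksubsets k n" by (auto simp: nonvanishing_def)
  obtain \<sigma> where \<sigma>: "(generic_minor k B * generic_minor k C :: (nat \<times> nat, 'k) mpol) =
      (\<Sum>x\<in>B - C. (if \<sigma> x then 1 else -1) *
         (generic_minor k (insert y (B - {x})) * generic_minor k (insert x (C - {y}))))"
    using generic_minor_exchange[OF B C] y by blast
  have ks: "insert y (B - {x}) \<in> ksubsets k n" "insert x (C - {y}) \<in> ksubsets k n" if "x \<in> B - C" for x
    using exchange_ksubsets[OF B C, of x y] exchange_ksubsets[OF C B, of y x] that y by auto
  define r :: "nat \<Rightarrow> (nat set, 'k) mpol" where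
    "r x = (if \<sigma> x then 1 else -1) * (mvar (insert y (B - {x})) * mvar (insert x (C - {y})))" for x
  \<comment> \<open>The exchange relation, lifted to the polynomial ring in the Pluecker variables.\<close>
  define s where "s = (\<Sum>x\<in>B - C. r x)"
  have prod_closed: "mvar \<alpha> * mvar \<alpha>' \<in> carrier ?P" if "\<alpha> \<in> ksubsets k n" "\<alpha>' \<in> ksubsets k n" for \<alpha> \<alpha>'
    using that J.m_closed[OF mvar_closed mvar_closed] by simp
  have sign_closed: "(if b then 1 else -1) \<in> carrier ?P" for b
    by (simp add: mvars_1 mvars_uminus)
  have r_closed: "r x \<in> carrier ?P" if "x \<in> B - C" for x
    using J.m_closed[OF sign_closed prod_closed[OF ks[OF that]]] by (simp only: r_def poly_ring_simps)
  have s_closed: "s \<in> carrier ?P"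
    unfolding s_def by (rule sum_mem_ideal_poly_ring[OF J.oneideal r_closed])
  have minus_s: "- s \<in> carrier ?P" using s_closed by (simp add: mvars_uminus)
  have "mvar B * mvar C + - s \<in> plucker_ideal K k n"
  proof -
    have "msubst (generic_minor k) (r x) = (if \<sigma> x then 1 else -1) *
        (generic_minor k (insert y (B - {x})) * generic_minor k (insert x (C - {y})))" for x
      by (simp add: r_def msubst_mult msubst_uminus)
    then have "msubst (generic_minor k) (mvar B * mvar C + - s) = 0"
      by (simp add: msubst_add msubst_uminus msubst_mult s_def msubst_sum \<sigma> del: add_uminus_conv_diff)
    moreover have "mvar B * mvar C + - s \<in> carrier ?P"
      using J.add.m_closed[OF prod_closed[OF B C] minus_s] by simp
    ultimately show ?thesis by (simp only: plucker_ideal_def mem_Collect_eq)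
  qed
  then have rel: "mvar B * mvar C + - s \<in> J" using IJ by blast
  show "\<exists>x\<in>B - C. insert y (B - {x}) \<in> nonvanishing K k n M p \<and> insert x (C - {y}) \<in> nonvanishing K k n M p"
  proof (rule ccontr)
    assume none: "\<not> ?thesis"
    have "r x \<in> J" if x: "x \<in> B - C" for x
    proof -
      have "mvar (insert y (B - {x})) \<in> J \<or> mvar (insert x (C - {y})) \<in> J"
        using none x mem ks[OF x] by blast
      then have "mvar (insert y (B - {x})) * mvar (insert x (C - {y})) \<in> J"
        using J.I_l_closed[OF _ mvar_closed[OF ks(1)[OF x]]] J.I_r_closed[OF _ mvar_closed[OF ks(2)[OF x]]]
        by auto
      then show ?thesis using J.I_l_closed[OF _ sign_closed] by (simp only: r_def poly_ring_simps)
    qed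
    then have sJ: "s \<in> J" unfolding s_def by (rule sum_mem_ideal_poly_ring[OF J.is_ideal])
    have "mvar B \<otimes>\<^bsub>?P\<^esub> mvar C \<in> J"
      using additive_subgroup.a_closed[OF ideal.axioms(1)[OF J.is_ideal] rel sJ] by simp
    then have "mvar B \<in> J \<or> mvar C \<in> J" by (rule J.I_prime[OF mvar_closed[OF B] mvar_closed[OF C]])
    then show False using BC mem B C by blast
  qed
qed

lemma nonvanishing_nonempty:
  fixes K :: "'k::field itself"
  assumes p: "p \<in> proj_points (coord_ring K k n M)"
  shows "nonvanishing K k n M p \<noteq> {}"
proof
  let ?P = "poly_ring (ksubsets k n) :: (nat set, 'k) mpol graded_ring"
  let ?J = "{f \<in> carrier ?P. coord_class K k n M f \<in> p}"
  assume "nonvanishing K k n M p = {}"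
  then have "mvar \<alpha> \<in> ?J" if "\<alpha> \<in> ksubsets k n" for \<alpha>
    using that mvar_closed[OF that] by (auto simp: nonvanishing_def coord_fun_eq)
  then have "grade ?P d \<subseteq> ?J" if "1 \<le> d" for d
    using that by (intro grade_subset_of_variables primeideal.axioms(1)[OF prime_pullback(1)[OF p]])
  then have sub: "(\<Union>d\<in>{1..}. grade (coord_ring K k n M) d) \<subseteq> p"
    unfolding grade_coord_ring by fastforce
  have "primeideal p (coord_ring K k n M)" using p by (simp add: proj_points_def)
  then interpret p: primeideal p "coord_ring K k n M" .
  have "irrelevant_ideal (coord_ring K k n M) \<subseteq> p"
    unfolding irrelevant_ideal_def by (rule p.genideal_minimal[OF p.is_ideal sub])
  then show False using p by (simp add: proj_points_def)
qed

lemma nonvanishing_subset: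
  assumes p: "p \<in> proj_points (coord_ring K k n M)"
  shows "nonvanishing K k n M p \<subseteq> M"
proof
  fix \<alpha> assume \<alpha>: "\<alpha> \<in> nonvanishing K k n M p"
  have "primeideal p (coord_ring K k n M)" using p by (simp add: proj_points_def)
  then have zero_p: "\<zero>\<^bsub>coord_ring K k n M\<^esub> \<in> p"
    by (intro additive_subgroup.zero_closed ideal.axioms(1) primeideal.axioms(1))
  show "\<alpha> \<in> M"
  proof (rule ccontr)
    assume "\<alpha> \<notin> M"
    then have "\<alpha> \<in> ksubsets k n - M" using \<alpha> by (simp add: nonvanishing_def)
    then have "coord_fun K k n M \<alpha> = \<zero>\<^bsub>coord_ring K k n M\<^esub>"
      unfolding coord_fun_def
      using coset_vanishing_zero_iff[OF plucker_coord_closed] plucker_coord_vanishing by blast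
    then show False using \<alpha> zero_p by (simp add: nonvanishing_def)
  qed
qed

text \<open>The kernel of the projection between the two coordinate rings is generated by the \<open>\<Delta>\<^sub>\<alpha>\<close> with
  \<open>\<alpha> \<notin> M\<close>, so \<open>p\<close> comes from a point of the closed subscheme if and only if it contains all of them.\<close>

lemma mem_closed_points_iff:
  assumes MN: "M \<subseteq> N" and p: "p \<in> proj_points (coord_ring K k n N)"
  shows "p \<in> closed_points_in K k n N M \<longleftrightarrow> nonvanishing K k n N p \<subseteq> M"
proof -
  let ?A = "plucker_algebra K k n"
  let ?h = "\<lambda>c. vanishing_ideal K k n M <+>\<^bsub>?A\<^esub> c"
  interpret h: graded_surjection "coord_ring K k n N" "coord_ring K k n M" ?h
    unfolding coord_ring_def
    by (rule graded_surjection_quot_quot[OF cring_plucker_algebra ideal_vanishing ideal_vanishing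
          vanishing_ideal_antimono[OF MN] grade_plucker_algebra_closed])
  interpret N: graded_surjection ?A "coord_ring K k n N" "\<lambda>a. vanishing_ideal K k n N +>\<^bsub>?A\<^esub> a"
    by (rule graded_surjection_coord_ring)
  have h_coset: "?h (vanishing_ideal K k n N +>\<^bsub>?A\<^esub> a) = vanishing_ideal K k n M +>\<^bsub>?A\<^esub> a"
    if "a \<in> carrier ?A" for a
    by (rule coset_enlarge[OF ideal_vanishing ideal_vanishing vanishing_ideal_antimono[OF MN] that])
  have prime: "primeideal p (coord_ring K k n N)" using p by (simp add: proj_points_def)
  show ?thesis
  proof
    assume "p \<in> closed_points_in K k n N M"
    then obtain q where q: "q \<in> proj_points (coord_ring K k n M)"
      "p = {c \<in> carrier (coord_ring K k n N). ?h c \<in> q}"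
      unfolding closed_points_in_def topspace_coord by blast
    have "primeideal q (coord_ring K k n M)" using q(1) by (simp add: proj_points_def)
    then have zero_q: "\<zero>\<^bsub>coord_ring K k n M\<^esub> \<in> q"
      by (intro additive_subgroup.zero_closed ideal.axioms(1) primeideal.axioms(1))
    show "nonvanishing K k n N p \<subseteq> M"
    proof
      fix \<alpha> assume \<alpha>: "\<alpha> \<in> nonvanishing K k n N p"
      then have ks: "\<alpha> \<in> ksubsets k n" by (simp add: nonvanishing_def)
      note closed = plucker_coord_closed[OF ks]
      show "\<alpha> \<in> M"
      proof (rule ccontr)
        assume "\<alpha> \<notin> M"
        then have "?h (coord_fun K k n N \<alpha>) = \<zero>\<^bsub>coord_ring K k n M\<^esub>"
          unfolding coord_fun_def h_coset[OF closed] coset_vanishing_zero_iff[OF closed]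
          using ks by (intro plucker_coord_vanishing) blast
        moreover have "coord_fun K k n N \<alpha> \<in> carrier (coord_ring K k n N)"
          unfolding coord_fun_def by (rule N.hom_closed[OF closed])
        ultimately have "coord_fun K k n N \<alpha> \<in> p" using q(2) zero_q by simp
        then show False using \<alpha> by (simp add: nonvanishing_def)
      qed
    qed
  next
    assume sub: "nonvanishing K k n N p \<subseteq> M"
    let ?Q = "{a \<in> carrier ?A. vanishing_ideal K k n N +>\<^bsub>?A\<^esub> a \<in> p}"
    have "ideal ?Q ?A" by (rule N.ring.ideal_vimage[OF primeideal.axioms(1)[OF prime]])
    moreover have "plucker_coord K k n \<alpha> \<in> ?Q" if "\<alpha> \<in> ksubsets k n - M" for \<alpha>
      using that sub plucker_coord_closed by (auto simp: nonvanishing_def coord_fun_def)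
    ultimately have VQ: "vanishing_ideal K k n M \<subseteq> ?Q" by (rule vanishing_ideal_minimal)
    \<comment> \<open>Since \<open>vanishing_ideal K k n M\<close> is generated by coordinates that vanish at \<open>p\<close>, the kernel of
      the projection lies in \<open>p\<close>.\<close>
    have ker: "c \<in> p" if c: "c \<in> carrier (coord_ring K k n N)" "?h c = \<zero>\<^bsub>coord_ring K k n M\<^esub>" for c
    proof -
      obtain a where a: "a \<in> carrier ?A" "c = vanishing_ideal K k n N +>\<^bsub>?A\<^esub> a"
        using c(1) unfolding N.surj[symmetric] by blast
      then have "a \<in> vanishing_ideal K k n M"
        using c(2) h_coset[OF a(1)] coset_vanishing_zero_iff[OF a(1)] by metis
      then show "c \<in> p" using VQ a(2) by blast
    qed
    obtain q where "q \<in> proj_points (coord_ring K k n M)"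
      "p = {c \<in> carrier (coord_ring K k n N). ?h c \<in> q}"
      using h.proj_point_image[OF p ker] by blast
    then show "p \<in> closed_points_in K k n N M"
      unfolding closed_points_in_def topspace_coord by blast
  qed
qed

lemma Sigma_subset_pinterval:
  assumes "N \<in> Sigma0 k n \<beta> \<gamma> \<union> Sigma1 k n \<beta> \<gamma> \<union> Sigma2 k n \<beta> \<gamma>"
  shows "N \<subseteq> pinterval k n \<beta> \<gamma>"
proof -
  from assms consider (0) t where "N = Pset k n \<beta> \<gamma> t"
    | (1) \<beta>' where "N = pinterval k n \<beta>' \<gamma>" "ple k \<beta> \<beta>'"
    | (2) \<gamma>' where "N = pinterval k n \<beta> \<gamma>'" "ple k \<gamma>' \<gamma>"
    by (auto simp: Sigma0_def Sigma1_def Sigma2_def pcovers_def)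
  then show ?thesis
  proof cases
    case 0
    then show ?thesis by (auto simp: Pset_def)
  next
    case 1
    then show ?thesis using ple_trans[OF 1(2)] by (auto simp: pinterval_def)
  next
    case 2
    then show ?thesis using ple_trans[OF _ 2(2)] by (auto simp: pinterval_def)
  qed
qed

theorem mainTheorem6:
  fixes K :: "'k::field itself" and k n :: nat and \<beta> \<gamma> :: "nat set"
    and \<Sigma> :: "nat set set set"
  assumes "1 \<le> k" and "k \<le> n"
    and "\<beta> \<in> ksubsets k n" and "\<gamma> \<in> ksubsets k n" and "ple k \<beta> \<gamma>"
    and "\<Sigma> = Sigma0 k n \<beta> \<gamma> \<union> Sigma1 k n \<beta> \<gamma> \<union> Sigma2 k n \<beta> \<gamma>"
  shows "(\<forall>M\<in>\<Sigma>. positroid k n M) \<and>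
    (let X = richardson K k n \<beta> \<gamma>;
         U = topspace (rs_top X) - (\<Union>M\<in>\<Sigma>. closed_points_in K k n (pinterval k n \<beta> \<gamma>) M)
     in openin (rs_top X) U \<and> W_open K k n \<beta> \<gamma> = open_subscheme X U)"
proof -
  let ?N = "pinterval k n \<beta> \<gamma>"
  let ?R = "coord_ring K k n ?N"
  define X where "X = richardson K k n \<beta> \<gamma>"
  define U where "U = topspace (rs_top X) - (\<Union>M\<in>\<Sigma>. closed_points_in K k n ?N M)"
  define W where "W = {p \<in> topspace (rs_top X). \<forall>t\<in>{0..k}. coord_fun K k n ?N (delta k \<beta> \<gamma> t) \<notin> p}"
  have top: "rs_top X = proj_topology ?R" "topspace (rs_top X) = proj_points ?R"
    unfolding X_def richardson_def topspace_coord by (simp_all add: X_of_def Proj_def)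
  have delta: "delta k \<beta> \<gamma> t \<in> ksubsets k n" if "t \<in> {0..k}" for t
    using delta_in_ksubsets[OF assms(3-5)] that by simp
  have "p \<in> W \<longleftrightarrow> p \<in> U" if p: "p \<in> proj_points ?R" for p
  proof -
    let ?M = "nonvanishing K k n ?N p"
    have "p \<in> W \<longleftrightarrow> (\<forall>t\<in>{0..k}. delta k \<beta> \<gamma> t \<in> ?M)"
      unfolding W_def top(2) nonvanishing_def using p delta by blast
    also have "\<dots> \<longleftrightarrow> (\<forall>M\<in>\<Sigma>. \<not> ?M \<subseteq> M)"
      unfolding assms(6)
      by (rule delta_mem_iff_not_subset[OF assms(1,3,4) symmetric_exchange_nonvanishing[OF p]
            nonvanishing_subset[OF p] nonvanishing_nonempty[OF p]])
    also have "\<dots> \<longleftrightarrow> (\<forall>M\<in>\<Sigma>. p \<notin> closed_points_in K k n ?N M)"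
      using mem_closed_points_iff[OF Sigma_subset_pinterval p] assms(6) by blast
    also have "\<dots> \<longleftrightarrow> p \<in> U" unfolding U_def top(2) using p by blast
    finally show ?thesis .
  qed
  then have WU: "W = U" unfolding W_def U_def top(2) by blast
  have "W = topspace (rs_top X) \<inter>
      (\<Inter>t\<in>{0..k}. {p \<in> proj_points ?R. coord_fun K k n ?N (delta k \<beta> \<gamma> t) \<notin> p})"
    unfolding W_def top(2) by blast
  moreover have "openin (rs_top X) \<dots>"
    unfolding top(1) using openin_basic_proj[OF coord_fun_homog[OF delta]]
    by (intro openin_Int openin_topspace openin_INT2) auto
  ultimately have "openin (rs_top X) U" using WU by simp
  moreover have "W_open K k n \<beta> \<gamma> = open_subscheme X U"
    unfolding W_open_def WU[symmetric] W_def X_def ..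
  moreover have "\<forall>M\<in>\<Sigma>. positroid k n M"
    using positroid_Sigma[OF assms(1-4)] assms(6) by blast
  ultimately show ?thesis unfolding Let_def X_def[symmetric] U_def[symmetric] by blast
qed


end
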